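(* Fix a variable layout, i.e. numbers $M\ge1$, $N\ge0$, $M_i,N_j\ge0$ and assertion variables $a_{i,k}$ ($1\le k\le M_i$), $b_{j,k}$ ($1\le k\le N_j$) with every $b_{j,k}$ among the $a_{i,k}$. Let $L=\{(i,j)\mid1\le i\le M,1\le j\le N\}$. Suppose the layout satisfies none of the following three criteria: (Shadow) both (S1): for all $(i,j)\in L$ with $\Pi(i)\not\ge\Omega(j)$ there is $c\in V$ with $\Pi(i)(c)<\Omega(j)(c)$ and $\Pi(k)(c)=\Omega(l)(c)$ for all $(k,l)\in L$ with $\Pi(k)\ge\Omega(l)$; and (S2): for all $1\le j\le N$ there is $c\in V$ with $\Omega(j)(c)>0$ and $\Pi(k)(c)=\Omega(l)(c)$ for all $(k,l)\in L$ with $\Pi(k)\ge\Omega(l)$; (Balloon) there is $B\subseteq V$ with $\sum_{c\in B}\Pi(i)(c)\le1$ for all $i$; for all $j$, $\sum_{c\in V}\Omega(j)(c)=0$ or $\sum_{c\in B}\Omega(j)(c)=1$; and for all $(i,j)\in L$ with $\Pi(i)\not\ge\Omega(j)$ some $c\in B$ has $\Pi(i)(c)<\Omega(j)(c)$; (Lonely) $M=1$ and $\Pi(1)\ge\Omega(j)$ for all $1\le j\le N$. Then there exist assertions $\varphi_1,\dots,\varphi_M,\psi_1,\dots,\psi_N$ containing no assertion variables such that the implication $\bigwedge_{i}\varphi_i*a_{i,1}*\cdots*a_{i,M_i}\Rightarrow\bigvee_j\psi_j*b_{j,1}*\cdots*b_{j,N_j}$ holds in the unary interpretation ($\models^1$)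 but not in the binary interpretation ($\not\models^2$).
   Context: $\mathsf{Heap}$: finite partial functions $\mathsf{PosInt}\to\mathsf{Int}$; $g\sqsubseteq h$ means $h$ extends $g$; $h\cdot g$ union of disjoint heaps; componentwise on $\mathsf{Heap}^n$. $\mathsf{IRel}_n$: upward closed subsets of $\mathsf{Heap}^n$; $p*q=\{\mathbf f\cdot\mathbf g\mid\mathbf f\in p,\mathbf g\in q,\text{componentwise disjoint}\}$; $\Delta_n(X)=\{(h_1,\dots,h_n)\mid\exists f\in X.\ \forall k.\ f\sqsubseteq h_k\}$. Assertions: built from primitive assertions $P$ (e.g. $E\hookrightarrow F$), assertion variables, $\mathsf{true},\mathsf{false},\wedge,\vee,*$, quantifiers over integer variables. $n$-ary meaning under $\eta$ (ordinary variables to integers) and $\rho:\mathsf{AVar}\to\mathsf{IRel}_n$: $[\![P]\!]^n=\Delta_n([\![P]\!]^{\mathrm{prim}}_\eta)$ with the standard meaning $[\![P]\!]^{\mathrm{prim}}_\eta\subseteq\mathsf{Heap}$, $[\![a]\!]^n=\rho(a)$, connectives by $\mathsf{Heap}^n,\emptyset,\cap,\cup,*$, quantifiers by unions/intersections. $\varphi\models^n\psi$ means $[\![\varphi]\!]^n_{\eta,\rho}\subseteq[\![\psi]\!]^n_{\eta,\rho}$ for all $\eta$ and all $\rho:\mathsf{AVar}\to\mathsf{IRel}_n$. $V=\{a_{i,k}\}$; $\Pi(i)(c)=|\{k\mid a_{i,k}=c\}|$, $\Omega(j)(c)=|\{k\mid b_{j,k}=c\}|$ for $c\in V$; $\Pi(i)\ge\Omega(j)$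 iff $\Pi(i)(c)\ge\Omega(j)(c)$ for all $c\in V$, and $\Pi(i)\not\ge\Omega(j)$ otherwise. *)

theory Defs
  imports Main
begin

type_synonym heap = "int \<rightharpoonup> int"

definition valid_heap :: "heap \<Rightarrow> bool" where
  "valid_heap h \<longleftrightarrow> finite (dom h) \<and> dom h \<subseteq> {0<..}"

definition Heaps :: "nat \<Rightarrow> heap list set" where
  "Heaps n = {hs. length hs = n \<and> (\<forall>h\<in>set hs. valid_heap h)}"

definition ext_tuple :: "heap list \<Rightarrow> heap list \<Rightarrow> bool" where
  "ext_tuple fs hs \<longleftrightarrow> list_all2 (\<lambda>f h. f \<subseteq>\<^sub>m h) fs hs"

definition IRel :: "nat \<Rightarrow> heap list set \<Rightarrow> bool" where
  "IRel n X \<longleftrightarrow> X \<subseteq> Heaps n \<and>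
     (\<forall>fs\<in>X. \<forall>hs\<in>Heaps n. ext_tuple fs hs \<longrightarrow> hs \<in> X)"

definition sep :: "heap list set \<Rightarrow> heap list set \<Rightarrow> heap list set" where
  "sep p q = {map2 (++) fs gs | fs gs. fs \<in> p \<and> gs \<in> q \<and> length fs = length gs \<and>
                 (\<forall>k<length fs. dom (fs ! k) \<inter> dom (gs ! k) = {})}"

definition Delta :: "nat \<Rightarrow> heap set \<Rightarrow> heap list set" where
  "Delta n X = {hs \<in> Heaps n. \<exists>f\<in>X. \<forall>h\<in>set hs. f \<subseteq>\<^sub>m h}"

datatype expr = EVar nat | EConst int | EPlus expr expr | EMinus expr expr | ETimes expr expr

primrec eval :: "(nat \<Rightarrow> int) \<Rightarrow> expr \<Rightarrow> int" where
  "eval \<eta> (EVar x) = \<eta> x"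
| "eval \<eta> (EConst c) = c"
| "eval \<eta> (EPlus e f) = eval \<eta> e + eval \<eta> f"
| "eval \<eta> (EMinus e f) = eval \<eta> e - eval \<eta> f"
| "eval \<eta> (ETimes e f) = eval \<eta> e * eval \<eta> f"

datatype prim = Emp | PointsTo expr expr | Hook expr expr | EqE expr expr

primrec prim_sem :: "(nat \<Rightarrow> int) \<Rightarrow> prim \<Rightarrow> heap set" where
  "prim_sem \<eta> Emp = {Map.empty}"
| "prim_sem \<eta> (PointsTo e f) =
     {h. eval \<eta> e > 0 \<and> h = [eval \<eta> e \<mapsto> eval \<eta> f]}"
| "prim_sem \<eta> (Hook e f) =
     {h. valid_heap h \<and> h (eval \<eta> e) = Some (eval \<eta> f)}"
| "prim_sem \<eta> (EqE e f) = {h. valid_heap h \<and> eval \<eta> e = eval \<eta> f}"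

datatype assn =
    Prim prim
  | AV nat
  | ATrue
  | AFalse
  | AAnd assn assn
  | AOr assn assn
  | AStar assn assn
  | AEx nat assn
  | AAll nat assn

primrec avars :: "assn \<Rightarrow> nat set" where
  "avars (Prim P) = {}"
| "avars (AV a) = {a}"
| "avars ATrue = {}"
| "avars AFalse = {}"
| "avars (AAnd p q) = avars p \<union> avars q"
| "avars (AOr p q) = avars p \<union> avars q"
| "avars (AStar p q) = avars p \<union> avars q"
| "avars (AEx x p) = avars p"
| "avars (AAll x p) = avars p"

primrec sem :: "nat \<Rightarrow> (nat \<Rightarrow> heap list set) \<Rightarrow> assn \<Rightarrow> (nat \<Rightarrow> int) \<Rightarrow> heap list set" where
  "sem n \<rho> (Prim P) \<eta> = Delta n (prim_sem \<eta> P)"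
| "sem n \<rho> (AV a) \<eta> = \<rho> a"
| "sem n \<rho> ATrue \<eta> = Heaps n"
| "sem n \<rho> AFalse \<eta> = {}"
| "sem n \<rho> (AAnd p q) \<eta> = sem n \<rho> p \<eta> \<inter> sem n \<rho> q \<eta>"
| "sem n \<rho> (AOr p q) \<eta> = sem n \<rho> p \<eta> \<union> sem n \<rho> q \<eta>"
| "sem n \<rho> (AStar p q) \<eta> = sep (sem n \<rho> p \<eta>) (sem n \<rho> q \<eta>)"
| "sem n \<rho> (AEx x p) \<eta> = (\<Union>v. sem n \<rho> p (\<eta>(x := v)))"
| "sem n \<rho> (AAll x p) \<eta> = (\<Inter>v. sem n \<rho> p (\<eta>(x := v)))"

definition entails :: "nat \<Rightarrow> assn \<Rightarrow> assn \<Rightarrow> bool" where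
  "entails n \<phi> \<psi> \<longleftrightarrow>
     (\<forall>\<eta> \<rho>. (\<forall>a. IRel n (\<rho> a)) \<longrightarrow> sem n \<rho> \<phi> \<eta> \<subseteq> sem n \<rho> \<psi> \<eta>)"

text \<open>A layout: list A of length M (A!i = [a_{i,1},...,a_{i,M_i}]) and
  list B of length N (B!j = [b_{j,1},...,b_{j,N_j}]); indices are 0-based.\<close>

definition Vset :: "nat list list \<Rightarrow> nat set" where
  "Vset A = (\<Union>xs\<in>set A. set xs)"

definition Pi :: "nat list list \<Rightarrow> nat \<Rightarrow> nat \<Rightarrow> nat" where
  "Pi A i c = count_list (A ! i) c"

definition Om :: "nat list list \<Rightarrow> nat \<Rightarrow> nat \<Rightarrow> nat" where
  "Om B j c = count_list (B ! j) c"

definition ge :: "nat list list \<Rightarrow> nat list list \<Rightarrow> nat \<Rightarrow> nat \<Rightarrow> bool" where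
  "ge A B i j \<longleftrightarrow> (\<forall>c\<in>Vset A. Pi A i c \<ge> Om B j c)"

definition Lset :: "nat list list \<Rightarrow> nat list list \<Rightarrow> (nat \<times> nat) set" where
  "Lset A B = {(i, j). i < length A \<and> j < length B}"

definition balanced_at :: "nat list list \<Rightarrow> nat list list \<Rightarrow> nat \<Rightarrow> bool" where
  "balanced_at A B c \<longleftrightarrow> (\<forall>(k, l)\<in>Lset A B. ge A B k l \<longrightarrow> Pi A k c = Om B l c)"

definition shadow :: "nat list list \<Rightarrow> nat list list \<Rightarrow> bool" where
  "shadow A B \<longleftrightarrow>
     (\<forall>(i, j)\<in>Lset A B. \<not> ge A B i j \<longrightarrow>
        (\<exists>c\<in>Vset A. Pi A i c < Om B j c \<and> balanced_at A B c)) \<and>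
     (\<forall>j<length B. \<exists>c\<in>Vset A. Om B j c > 0 \<and> balanced_at A B c)"

definition balloon :: "nat list list \<Rightarrow> nat list list \<Rightarrow> bool" where
  "balloon A B \<longleftrightarrow> (\<exists>Bs \<subseteq> Vset A.
     (\<forall>i<length A. (\<Sum>c\<in>Bs. Pi A i c) \<le> 1) \<and>
     (\<forall>j<length B. (\<Sum>c\<in>Vset A. Om B j c) = 0 \<or> (\<Sum>c\<in>Bs. Om B j c) = 1) \<and>
     (\<forall>(i, j)\<in>Lset A B. \<not> ge A B i j \<longrightarrow> (\<exists>c\<in>Bs. Pi A i c < Om B j c)))"

definition lonely :: "nat list list \<Rightarrow> nat list list \<Rightarrow> bool" where
  "lonely A B \<longleftrightarrow> length A = 1 \<and> (\<forall>j<length B. ge A B 0 j)"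

definition star_vars :: "assn \<Rightarrow> nat list \<Rightarrow> assn" where
  "star_vars \<phi> as = foldl (\<lambda>p a. AStar p (AV a)) \<phi> as"

definition big_and :: "assn list \<Rightarrow> assn" where
  "big_and ps = foldr AAnd ps ATrue"

definition big_or :: "assn list \<Rightarrow> assn" where
  "big_or ps = foldr AOr ps AFalse"

definition lhs_of :: "assn list \<Rightarrow> nat list list \<Rightarrow> assn" where
  "lhs_of \<phi>s A = big_and (map2 star_vars \<phi>s A)"

definition rhs_of :: "assn list \<Rightarrow> nat list list \<Rightarrow> assn" where
  "rhs_of \<psi>s B = big_or (map2 star_vars \<psi>s B)"

end

(* The separating implication is read off a single binary counterexample. A finite set of cells
   is common to both components h1 and h2; phi_i owns every cell except those labelled (i, p, q),
   and a cell (i, p, q) lies in the p-th piece of conjunct i in h1 and in the q-th one in h2. The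
   heap h1 also contains junk making all pieces of different conjuncts overlap, so a disjunct j can
   only be met by an embedding of its variables into those of one conjunct. The formula psi_j is
   the weakest one that refutes all these embeddings: it asks for a location outside each of the
   possible remainders.

   Unary validity then becomes a covering game, lost only if some choice of pieces defeats all
   disjuncts. In a lost position let W be the set of variables none of whose pieces is empty. Every
   pair (i, j) with Pi(i) not above Omega(j) is witnessed in W, and W meets every nonempty disjunct.
   If no disjunct is variable-free then every variable in W is balanced, which is (Shadow);
   otherwise the heap consists of cells only, and W is a (Balloon). The cells of conjunct i are
   chosen so that a lost position must put them into one piece used by all embeddings into
   conjunct i: a single cell if there is such a piece, and all pairs otherwise. If there
   is only one conjunct, or some disjunct is variable-free and another one embeds nowhere, no cells
   are used at all; a disjunct that embeds nowhere, which for M = 1 is what the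
   failure of (Lonely) provides, is then met by any choice of pieces. *)

theory Submission
  imports Defs "HOL-Library.Nat_Bijection"
begin

section \<open>Semantics of assertions\<close>

lemma Heaps_iff_nth: "hs \<in> Heaps n \<longleftrightarrow> length hs = n \<and> (\<forall>i<n. valid_heap (hs ! i))"
  by (auto simp: Heaps_def all_set_conv_all_nth)

lemma ext_tuple_iff_nth:
  "ext_tuple fs hs \<longleftrightarrow> length fs = length hs \<and> (\<forall>i<length hs. fs ! i \<subseteq>\<^sub>m hs ! i)"
  by (auto simp: ext_tuple_def list_all2_conv_all_nth)

lemma ext_tuple_trans: "ext_tuple fs gs \<Longrightarrow> ext_tuple gs hs \<Longrightarrow> ext_tuple fs hs"
  by (auto simp: ext_tuple_iff_nth intro: map_le_trans)

lemma valid_heap_restrict: "valid_heap h \<Longrightarrow> valid_heap (h |` S)"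
  by (auto simp: valid_heap_def)

text \<open>The odd part of \<open>d\<close> serves as \<open>2 * v + 1\<close>. Each factor 2 is
  absorbed by passing from \<open>3 * w + 1\<close> to \<open>4 * (3 * w + 1)\<close>, which is
  again 1 modulo 3.\<close>

lemma dvd_product_odd_one_mod_three:
  fixes d :: int
  assumes "d \<noteq> 0"
  shows "\<exists>u v w. u * d = (2 * v + 1) * (3 * w + 1)"
  using assms
proof (induction "nat \<bar>d\<bar>" arbitrary: d rule: less_induct)
  case less
  show ?case
  proof (cases "even d")
    case True
    then obtain e where e: "d = 2 * e" by blast
    then have "\<exists>u v w. u * e = (2 * v + 1) * (3 * w + 1)"
      using less.prems by (intro less.hyps) auto
    then obtain u v w where "u * e = (2 * v + 1) * (3 * w + 1)" by blast
    then have "(2 * u) * d = (2 * v + 1) * (3 * (4 * w + 1) + 1)"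
      using e by (simp add: algebra_simps)
    then show ?thesis by blast
  next
    case False
    then obtain v where "d = 2 * v + 1" by (auto elim: oddE)
    then have "1 * d = (2 * v + 1) * (3 * 0 + 1)" by simp
    then show ?thesis by blast
  qed
qed

text \<open>The language has no negation; \<open>x \<noteq> c\<close> is expressed by saying that \<open>x - c\<close> divides a
  product of the form \<open>(2 v + 1) (3 w + 1)\<close>.\<close>

definition neq_assn :: "int \<Rightarrow> assn" where
  "neq_assn c = AEx 2 (AEx 3 (AEx 4 (Prim (EqE
     (ETimes (EVar 2) (EMinus (EVar 0) (EConst c)))
     (ETimes (EPlus (ETimes (EConst 2) (EVar 3)) (EConst 1))
             (EPlus (ETimes (EConst 3) (EVar 4)) (EConst 1)))))))"

text \<open>The empty heap lies below every component of every tuple, so a condition that does not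
  mention the heap means the same for every \<open>n\<close>.\<close>

lemma Delta_pure: "Delta n {h. valid_heap h \<and> P} = (if P then Heaps n else {})"
proof -
  have "valid_heap Map.empty" by (simp add: valid_heap_def)
  then show ?thesis by (auto simp: Delta_def intro!: exI[of _ Map.empty])
qed

lemma sem_neq_assn: "sem n \<rho> (neq_assn c) \<eta> = (if \<eta> 0 \<noteq> c then Heaps n else {})"
proof -
  have "(\<exists>u v w :: int. u * (\<eta> 0 - c) = (2 * v + 1) * (3 * w + 1)) \<longleftrightarrow> \<eta> 0 \<noteq> c"
  proof
    assume "\<exists>u v w :: int. u * (\<eta> 0 - c) = (2 * v + 1) * (3 * w + 1)"
    then obtain u v w :: int where "u * (\<eta> 0 - c) = (2 * v + 1) * (3 * w + 1)" by blast
    \<comment> \<open>Neither factor vanishes over the integers, whereas \<open>\<eta> 0 = c\<close>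
      would make the left side zero.\<close>
    moreover have "2 * v + 1 \<noteq> 0" "3 * w + 1 \<noteq> 0" by presburger+
    ultimately show "\<eta> 0 \<noteq> c" by auto
  qed (use dvd_product_odd_one_mod_three[of "\<eta> 0 - c"] in simp)
  then show ?thesis by (auto simp: neq_assn_def Delta_pure split: if_splits)
qed

text \<open>The one-point heap is the least heap with value \<open>v\<close> at \<open>x\<close>, so
  a common subheap exists as soon as all components carry that value. Positivity of \<open>x\<close>
  comes from validity.\<close>

lemma Delta_hook:
  "Delta n {h. valid_heap h \<and> h x = Some v} = {hs \<in> Heaps n. 0 < x \<and> (\<forall>h\<in>set hs. h x = Some v)}"
proof -
  have "[x \<mapsto> v] \<subseteq>\<^sub>m h \<longleftrightarrow> h x = Some v" for h :: heap by (auto simp: map_le_def)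
  moreover have "valid_heap [x \<mapsto> v] \<longleftrightarrow> 0 < x" by (simp add: valid_heap_def)
  moreover have "0 < x" if "valid_heap f" "f x = Some v" for f using that by (auto simp: valid_heap_def)
  moreover have "h x = Some v" if "f x = Some v" "f \<subseteq>\<^sub>m h" for f h :: heap
    using that by (metis domI map_le_def)
  ultimately show ?thesis unfolding Delta_def by (fastforce intro: exI[of _ "[x \<mapsto> v]"])
qed

lemma var_avoiding_assn_exists:
  assumes "finite R"
  shows "\<exists>\<psi>. avars \<psi> = {} \<and> (\<forall>n \<rho> \<eta>. sem n \<rho> \<psi> \<eta> = (if \<eta> 0 \<notin> R then Heaps n else {}))"
  using assms
proof (induction R)
  case empty
  show ?case by (rule exI[of _ ATrue]) simp
next
  case (insert c R)
  then obtain \<psi> where "avars \<psi> = {}" "\<forall>n \<rho> \<eta>. sem n \<rho> \<psi> \<eta> = (if \<eta> 0 \<notin> R then Heaps n else {})"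
    by blast
  then show ?case
    by (intro exI[of _ "AAnd (neq_assn c) \<psi>"]) (simp add: sem_neq_assn, simp add: neq_assn_def)
qed

text \<open>Building block of the right-hand assertions. For one heap it says that the domain is not
  contained in \<open>R\<close>; for two heaps, location and content have to be common to
  both.\<close>

lemma escape_assn_exists:
  assumes "finite R"
  shows "\<exists>\<psi>. avars \<psi> = {} \<and> (\<forall>n \<rho> \<eta>. sem n \<rho> \<psi> \<eta> =
    {hs \<in> Heaps n. \<exists>x v. x \<notin> R \<and> 0 < x \<and> (\<forall>h\<in>set hs. h x = Some v)})"
proof -
  obtain \<psi> where "avars \<psi> = {}" "\<forall>n \<rho> \<eta>. sem n \<rho> \<psi> \<eta> = (if \<eta> 0 \<notin> R then Heaps n else {})"
    using var_avoiding_assn_exists[OF assms] by blast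
  note \<psi> = this
  \<comment> \<open>Variable 0 is the location tested by \<open>\<psi>\<close> and 1 its content;
    the meaning of \<open>\<psi>\<close> depends on 0 alone, so binding 1 does not disturb
    it.\<close>
  let ?\<psi> = "AEx 0 (AEx 1 (AAnd \<psi> (Prim (Hook (EVar 0) (EVar 1)))))"
  have "hs \<in> sem n \<rho> ?\<psi> \<eta> \<longleftrightarrow>
      hs \<in> Heaps n \<and> (\<exists>x v. x \<notin> R \<and> 0 < x \<and> (\<forall>h\<in>set hs. h x = Some v))" for n \<rho> \<eta> hs
  proof -
    have "hs \<in> sem n \<rho> ?\<psi> \<eta> \<longleftrightarrow> (\<exists>x v. hs \<in> (if x \<notin> R then Heaps n else {}) \<and>
        hs \<in> Heaps n \<and> 0 < x \<and> (\<forall>h\<in>set hs. h x = Some v))"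
      using \<psi>(2) by (simp add: Delta_hook)
    then show ?thesis by auto
  qed
  then have "sem n \<rho> ?\<psi> \<eta> =
      {hs \<in> Heaps n. \<exists>x v. x \<notin> R \<and> 0 < x \<and> (\<forall>h\<in>set hs. h x = Some v)}" for n \<rho> \<eta>
    by (intro set_eqI) (simp only: mem_Collect_eq)
  moreover have "avars ?\<psi> = {}" using \<psi>(1) by simp
  ultimately show ?thesis by blast
qed

lemma conj_assn_exists:
  assumes "finite I" "\<And>i. i \<in> I \<Longrightarrow> \<exists>\<psi>. avars \<psi> = {} \<and>
    (\<forall>n \<rho> \<eta>. sem n \<rho> \<psi> \<eta> = {hs \<in> Heaps n. Q i hs})"
  shows "\<exists>\<psi>. avars \<psi> = {} \<and> (\<forall>n \<rho> \<eta>. sem n \<rho> \<psi> \<eta> = {hs \<in> Heaps n. \<forall>i\<in>I. Q i hs})"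
  using assms
proof (induction I)
  case empty
  show ?case by (rule exI[of _ ATrue]) simp
next
  case (insert i I)
  obtain \<psi> where 1: "avars \<psi> = {}" "\<forall>n \<rho> \<eta>. sem n \<rho> \<psi> \<eta> = {hs \<in> Heaps n. \<forall>i\<in>I. Q i hs}"
    using insert.IH insert.prems by auto
  obtain \<psi>' where 2: "avars \<psi>' = {}" "\<forall>n \<rho> \<eta>. sem n \<rho> \<psi>' \<eta> = {hs \<in> Heaps n. Q i hs}"
    using insert.prems[of i] by blast
  show ?case by (rule exI[of _ "AAnd \<psi>' \<psi>"]) (use 1 2 in auto)
qed

lemma owns_assn_exists:
  assumes "finite T" "T \<subseteq> {0<..}"
  shows "\<exists>\<phi>. avars \<phi> = {} \<and> (\<forall>n \<rho> \<eta>. sem n \<rho> \<phi> \<eta> =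
    {hs \<in> Heaps n. \<forall>x\<in>T. \<forall>h\<in>set hs. h x = Some 0})"
proof (rule conj_assn_exists[OF assms(1)])
  fix x assume "x \<in> T"
  then show "\<exists>\<psi>. avars \<psi> = {} \<and> (\<forall>n \<rho> \<eta>. sem n \<rho> \<psi> \<eta> = {hs \<in> Heaps n. \<forall>h\<in>set hs. h x = Some 0})"
    using assms(2) by (intro exI[of _ "Prim (Hook (EConst x) (EConst 0))"]) (auto simp: Delta_hook)
qed

section \<open>Iterated separating conjunction with variables\<close>

definition rest :: "nat \<Rightarrow> heap list \<Rightarrow> (nat \<Rightarrow> heap list) \<Rightarrow> nat \<Rightarrow> heap list" where
  "rest n hs X m = map (\<lambda>i. (hs ! i) |` (- (\<Union>k<m. dom (X k ! i)))) [0..<n]"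

lemma star_vars_append: "star_vars \<phi> (as @ [a]) = AStar (star_vars \<phi> as) (AV a)"
  by (simp add: star_vars_def)

lemma rest_in_Heaps: "hs \<in> Heaps n \<Longrightarrow> rest n hs X m \<in> Heaps n"
  by (simp add: Heaps_iff_nth rest_def valid_heap_restrict)

text \<open>The nested stars are flattened into one simultaneous choice of pieces with an explicit
  remainder. The induction removes the last variable because \<open>star_vars\<close> folds from the
  left.\<close>

lemma sem_star_vars:
  assumes \<rho>: "\<And>a. \<rho> a \<subseteq> Heaps n" and \<phi>: "sem n \<rho> \<phi> \<eta> \<subseteq> Heaps n"
  shows "hs \<in> sem n \<rho> (star_vars \<phi> as) \<eta> \<longleftrightarrow> hs \<in> Heaps n \<and>
    (\<exists>X. (\<forall>k<length as. X k \<in> \<rho> (as ! k) \<and> ext_tuple (X k) hs) \<and>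
      (\<forall>k<length as. \<forall>k'<length as. k \<noteq> k' \<longrightarrow> (\<forall>i<n. dom (X k ! i) \<inter> dom (X k' ! i) = {})) \<and>
      rest n hs X (length as) \<in> sem n \<rho> \<phi> \<eta>)"
proof (induction as arbitrary: hs rule: rev_induct)
  case Nil
  have "rest n hs X 0 = hs" if "length hs = n" for X
    using that by (intro nth_equalityI) (auto simp: rest_def)
  then show ?case using \<phi> by (auto simp: star_vars_def Heaps_def)
next
  case (snoc a as)
  let ?m = "length as"
  show ?case (is "_ \<longleftrightarrow> ?R")
  proof
    assume "hs \<in> sem n \<rho> (star_vars \<phi> (as @ [a])) \<eta>"
    then obtain fs gs where hs: "hs = map2 (++) fs gs" and fs: "fs \<in> sem n \<rho> (star_vars \<phi> as) \<eta>"
      and gs: "gs \<in> \<rho> a" and disj: "\<forall>k<length fs. dom (fs ! k) \<inter> dom (gs ! k) = {}"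
      by (auto simp: star_vars_append sep_def)
    obtain X where X: "fs \<in> Heaps n" "\<forall>k<?m. X k \<in> \<rho> (as ! k) \<and> ext_tuple (X k) fs"
      "\<forall>k<?m. \<forall>k'<?m. k \<noteq> k' \<longrightarrow> (\<forall>i<n. dom (X k ! i) \<inter> dom (X k' ! i) = {})"
      "rest n fs X ?m \<in> sem n \<rho> \<phi> \<eta>"
      using fs snoc.IH by blast
    have gsH: "gs \<in> Heaps n" using gs \<rho> by blast
    have len: "length fs = n" "length gs = n" using X(1) gsH by (auto simp: Heaps_def)
    have hsi: "hs ! i = (fs ! i) ++ (gs ! i)" if "i < n" for i using that len hs by simp
    have disj': "dom (fs ! i) \<inter> dom (gs ! i) = {}" if "i < n" for i using that disj len by simp
    have hsH: "hs \<in> Heaps n"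
      using X(1) gsH len hs by (auto simp: Heaps_iff_nth valid_heap_def)
    have ext_f: "ext_tuple fs hs"
      unfolding ext_tuple_iff_nth using len hs hsi disj' map_add_comm by (metis length_map length_zip map_le_map_add min.idem)
    have ext_g: "ext_tuple gs hs"
      unfolding ext_tuple_iff_nth using len hs hsi by (simp add: map_le_map_add)
    let ?X = "X(?m := gs)"
    have sub: "dom (X k ! i) \<subseteq> dom (fs ! i)" if "k < ?m" "i < n" for k i
      using X(2) that len by (intro map_le_implies_dom_le) (simp add: ext_tuple_iff_nth)
    \<comment> \<open>Outside \<open>gs\<close> the tuples \<open>hs\<close> and \<open>fs\<close>
      agree, and the locations of \<open>gs\<close> are removed as piece \<open>?m\<close>.\<close>
    have "rest n hs ?X (Suc ?m) = rest n fs X ?m"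
      unfolding rest_def
    proof (rule map_cong[OF refl], rule ext)
      fix i x assume "i \<in> set [0..<n]"
      then have i: "i < n" by simp
      have *: "(\<Union>k<Suc ?m. dom (?X k ! i)) = (\<Union>k<?m. dom (X k ! i)) \<union> dom (gs ! i)"
        by (simp add: lessThan_Suc Un_commute cong: SUP_cong_simp)
      show "((hs ! i) |` (- (\<Union>k<Suc ?m. dom (?X k ! i)))) x =
          ((fs ! i) |` (- (\<Union>k<?m. dom (X k ! i)))) x"
      proof (cases "x \<in> dom (gs ! i)")
        case True
        then have "(fs ! i) x = None" using disj'[OF i] by blast
        then show ?thesis unfolding * restrict_map_def using True by simp
      next
        case False
        then have "(hs ! i) x = (fs ! i) x" by (simp add: hsi[OF i] map_add_dom_app_simps)
        then show ?thesis unfolding * restrict_map_def using False by simp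
      qed
    qed
    moreover have "dom (?X k ! i) \<inter> dom (?X k' ! i) = {}"
      if "k < Suc ?m" "k' < Suc ?m" "k \<noteq> k'" "i < n" for k k' i
    proof -
      have "dom (X k ! i) \<inter> dom (gs ! i) = {}" if "k < ?m" for k
        using sub[OF that \<open>i < n\<close>] disj'[OF \<open>i < n\<close>] by blast
      then show ?thesis using that X(3)[rule_format, of k k' i]
        by (cases "k = ?m"; cases "k' = ?m") (auto simp: less_Suc_eq Int_commute)
    qed
    moreover have "?X k \<in> \<rho> ((as @ [a]) ! k) \<and> ext_tuple (?X k) hs" if "k < Suc ?m" for k
      using that X(2) gs ext_f ext_g ext_tuple_trans by (auto simp: less_Suc_eq nth_append)
    ultimately show ?R using hsH X(4) by (intro conjI exI[of _ ?X]) (simp_all del: fun_upd_apply)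
  next
    assume ?R
    then obtain X where hsH: "hs \<in> Heaps n"
      and X: "\<forall>k<Suc ?m. X k \<in> \<rho> ((as @ [a]) ! k) \<and> ext_tuple (X k) hs"
      "\<forall>k<Suc ?m. \<forall>k'<Suc ?m. k \<noteq> k' \<longrightarrow> (\<forall>i<n. dom (X k ! i) \<inter> dom (X k' ! i) = {})"
      "rest n hs X (Suc ?m) \<in> sem n \<rho> \<phi> \<eta>" by auto
    \<comment> \<open>Conversely the first factor is \<open>hs\<close> with the last piece cut off;
      the other pieces survive in it, being disjoint from the last one.\<close>
    define fs where "fs = map (\<lambda>i. (hs ! i) |` (- dom (X ?m ! i))) [0..<n]"
    have gs: "X ?m \<in> \<rho> a" "ext_tuple (X ?m) hs" using X(1)[rule_format, of ?m] by simp_all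
    have len: "length hs = n" "length fs = n" "length (X ?m) = n"
      using hsH gs(2) by (simp_all add: Heaps_iff_nth fs_def ext_tuple_iff_nth)
    have fsi: "fs ! i = (hs ! i) |` (- dom (X ?m ! i))" if "i < n" for i using that by (simp add: fs_def)
    have fsH: "fs \<in> Heaps n" using hsH by (auto simp: Heaps_iff_nth fs_def valid_heap_restrict)
    have "rest n fs X ?m = rest n hs X (Suc ?m)"
      unfolding rest_def
    proof (rule map_cong[OF refl], rule ext)
      fix i x assume "i \<in> set [0..<n]"
      then have i: "i < n" by simp
      have "(\<Union>k<Suc ?m. dom (X k ! i)) = (\<Union>k<?m. dom (X k ! i)) \<union> dom (X ?m ! i)"
        by (simp add: lessThan_Suc Un_commute)
      then show "((fs ! i) |` (- (\<Union>k<?m. dom (X k ! i)))) x =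
          ((hs ! i) |` (- (\<Union>k<Suc ?m. dom (X k ! i)))) x"
        using fsi[OF i] by (auto simp: restrict_map_def)
    qed
    moreover have "ext_tuple (X k) fs" if k: "k < ?m" for k
      unfolding ext_tuple_iff_nth
    proof (intro conjI allI impI)
      have e: "ext_tuple (X k) hs" using X(1)[rule_format, of k] k by simp
      then show "length (X k) = length fs" using len by (simp add: ext_tuple_iff_nth)
      fix i assume "i < length fs"
      then have i: "i < n" using len by simp
      have "dom (X k ! i) \<inter> dom (X ?m ! i) = {}" using X(2)[rule_format, of k ?m i] k i by simp
      moreover have "X k ! i \<subseteq>\<^sub>m hs ! i" using e i len by (simp add: ext_tuple_iff_nth)
      ultimately show "X k ! i \<subseteq>\<^sub>m fs ! i"
        unfolding fsi[OF i] map_le_def restrict_map_def by auto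
    qed
    moreover have "X k \<in> \<rho> (as ! k)" if "k < ?m" for k
      using X(1)[rule_format, of k] that by (simp add: nth_append)
    ultimately have "fs \<in> sem n \<rho> (star_vars \<phi> as) \<eta>"
      unfolding snoc.IH using X(2,3) fsH by (intro conjI exI[of _ X]) auto
    moreover have "hs = map2 (++) fs (X ?m)"
    proof (rule nth_equalityI)
      fix i assume "i < length hs"
      then have i: "i < n" using len by simp
      have "X ?m ! i \<subseteq>\<^sub>m hs ! i" using gs(2) i len by (simp add: ext_tuple_iff_nth)
      then have "hs ! i = (fs ! i) ++ (X ?m ! i)"
        unfolding fsi[OF i] map_le_def
        by (intro ext) (auto simp: map_add_def restrict_map_def split: option.split)
      then show "hs ! i = map2 (++) fs (X ?m) ! i" using i len by simp
    qed (use len in simp)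
    moreover have "\<forall>i<length fs. dom (fs ! i) \<inter> dom (X ?m ! i) = {}" using fsi len by auto
    ultimately show "hs \<in> sem n \<rho> (star_vars \<phi> (as @ [a])) \<eta>"
      unfolding star_vars_append sem.simps sep_def mem_Collect_eq using gs(1) len
      by (intro exI[of _ fs] exI[of _ "X ?m"] conjI) simp_all
  qed
qed

lemma sem_big_and: "sem n \<rho> (big_and ps) \<eta> = Heaps n \<inter> (\<Inter>p\<in>set ps. sem n \<rho> p \<eta>)"
  unfolding big_and_def by (induction ps) auto

lemma sem_big_or: "sem n \<rho> (big_or ps) \<eta> = (\<Union>p\<in>set ps. sem n \<rho> p \<eta>)"
  unfolding big_or_def by (induction ps) auto

lemma sem_lhs_of:
  assumes "length \<phi>s = length A"
  shows "hs \<in> sem n \<rho> (lhs_of \<phi>s A) \<eta> \<longleftrightarrow>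
    hs \<in> Heaps n \<and> (\<forall>i<length A. hs \<in> sem n \<rho> (star_vars (\<phi>s ! i) (A ! i)) \<eta>)"
  using assms by (auto simp: lhs_of_def sem_big_and set_zip)

lemma sem_rhs_of:
  assumes "length \<psi>s = length B"
  shows "hs \<in> sem n \<rho> (rhs_of \<psi>s B) \<eta> \<longleftrightarrow>
    (\<exists>j<length B. hs \<in> sem n \<rho> (star_vars (\<psi>s ! j) (B ! j)) \<eta>)"
  using assms by (fastforce simp: rhs_of_def sem_big_or set_zip)

section \<open>The unary covering game\<close>

text \<open>\<open>S\<close> is the set of positions of \<open>as\<close> used by an injective, variable-preserving assignment
  of the positions of \<open>bs\<close>.\<close>

definition embeds :: "'a list \<Rightarrow> 'a list \<Rightarrow> nat set \<Rightarrow> bool" where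
  "embeds bs as S \<longleftrightarrow> (\<exists>s. inj_on s {..<length bs} \<and> S = s ` {..<length bs} \<and>
     (\<forall>k<length bs. s k < length as \<and> as ! s k = bs ! k))"

lemma count_list_card: "count_list xs c = card {k. k < length xs \<and> xs ! k = c}"
  by (simp add: count_list_eq_length_filter length_filter_conv_card eq_commute)

text \<open>An injection is chosen in each colour class separately; the classes are disjoint, so the
  injections glue together.\<close>

lemma colour_matching:
  assumes "finite K" "finite P"
    and "\<And>c. c \<in> \<beta> ` K \<Longrightarrow> card {k\<in>K. \<beta> k = c} \<le> card {p\<in>P. \<alpha> p = c}"
  shows "\<exists>s. inj_on s K \<and> s ` K \<subseteq> P \<and> (\<forall>k\<in>K. \<alpha> (s k) = \<beta> k)"
proof -
  have "\<forall>c\<in>\<beta> ` K. \<exists>f. f ` {k\<in>K. \<beta> k = c} \<subseteq> {p\<in>P. \<alpha> p = c} \<and> inj_on f {k\<in>K. \<beta> k = c}"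
    using assms by (intro ballI card_le_inj) auto
  from bchoice[OF this] obtain f where f: "\<And>c. c \<in> \<beta> ` K \<Longrightarrow>
      f c ` {k\<in>K. \<beta> k = c} \<subseteq> {p\<in>P. \<alpha> p = c} \<and> inj_on (f c) {k\<in>K. \<beta> k = c}"
    by blast
  define s where "s k = f (\<beta> k) k" for k
  have *: "s k \<in> P \<and> \<alpha> (s k) = \<beta> k" if "k \<in> K" for k
    using f[of "\<beta> k"] that unfolding s_def by blast
  have "inj_on s K"
  proof (rule inj_onI)
    fix k k' assume k: "k \<in> K" "k' \<in> K" "s k = s k'"
    then have "\<beta> k = \<beta> k'" using * by metis
    then show "k = k'" using k f[of "\<beta> k"] unfolding s_def inj_on_def by auto
  qed
  then show ?thesis using * by blast
qed

lemma embeds_count: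
  assumes "embeds bs as S" shows "count_list bs c \<le> count_list as c"
proof -
  obtain s where s: "inj_on s {..<length bs}"
    "\<forall>k<length bs. s k < length as \<and> as ! s k = bs ! k"
    using assms unfolding embeds_def by blast
  have "card {k. k < length bs \<and> bs ! k = c} \<le> card {k. k < length as \<and> as ! k = c}"
    by (rule card_inj_on_le[of s]) (use s in \<open>auto simp: inj_on_def\<close>)
  then show ?thesis by (simp add: count_list_card)
qed

text \<open>Colour matching with the variables as colours. Limiting the targets to \<open>P\<close>
  allows a given position to be avoided.\<close>

lemma embeds_exists:
  assumes "P \<subseteq> {..<length as}"
    and "\<And>c. c \<in> set bs \<Longrightarrow> count_list bs c \<le> card {p\<in>P. as ! p = c}"
  obtains S where "embeds bs as S" "S \<subseteq> P"
proof -
  have "finite P" using assms(1) finite_subset by blast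
  have "card {k \<in> {..<length bs}. bs ! k = c} \<le> card {p \<in> P. as ! p = c}"
    if "c \<in> (!) bs ` {..<length bs}" for c
    using assms(2)[of c] that by (auto simp: count_list_card)
  from colour_matching[of "{..<length bs}" P "(!) bs" "(!) as", OF _ \<open>finite P\<close> this]
  obtain s where "inj_on s {..<length bs}" "s ` {..<length bs} \<subseteq> P"
    "\<forall>k\<in>{..<length bs}. as ! s k = bs ! k"
    by auto
  then show ?thesis using that assms(1) unfolding embeds_def by (metis image_subset_iff lessThan_iff subsetD)
qed

lemma embeds_bound: "embeds bs as S \<Longrightarrow> S \<subseteq> {..<length as}"
  by (auto simp: embeds_def)

lemma embeds_nonempty: "embeds bs as S \<Longrightarrow> bs \<noteq> [] \<Longrightarrow> S \<noteq> {}"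
  by (auto simp: embeds_def)

lemma ge_iff_embeds:
  assumes "set (B ! j) \<subseteq> Vset A"
  shows "ge A B i j \<longleftrightarrow> (\<exists>S. embeds (B ! j) (A ! i) S)"
proof
  assume g: "ge A B i j"
  obtain S where "embeds (B ! j) (A ! i) S"
  proof (rule embeds_exists)
    show "{..<length (A ! i)} \<subseteq> {..<length (A ! i)}" ..
    show "count_list (B ! j) c \<le> card {p \<in> {..<length (A ! i)}. A ! i ! p = c}" if "c \<in> set (B ! j)" for c
      using g that assms by (auto simp: ge_def Pi_def Om_def count_list_card subset_eq)
  qed
  then show "\<exists>S. embeds (B ! j) (A ! i) S" ..
qed (auto simp: ge_def Pi_def Om_def embeds_count)

text \<open>Since the variable at \<open>v\<close> has a surplus in the conjunct, all its copies in
  the disjunct fit into the other positions.\<close>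

lemma embeds_avoiding:
  assumes "ge A B i j" "set (B ! j) \<subseteq> Vset A" "Om B j (A ! i ! v) < Pi A i (A ! i ! v)"
    "v < length (A ! i)"
  obtains S where "embeds (B ! j) (A ! i) S" "v \<notin> S"
proof (rule embeds_exists[of "{..<length (A ! i)} - {v}"])
  show "{..<length (A ! i)} - {v} \<subseteq> {..<length (A ! i)}" by auto
  show "count_list (B ! j) c \<le> card {p \<in> {..<length (A ! i)} - {v}. A ! i ! p = c}"
    if "c \<in> set (B ! j)" for c
  proof (cases "c = A ! i ! v")
    case True
    have "{p \<in> {..<length (A ! i)} - {v}. A ! i ! p = c} = {p. p < length (A ! i) \<and> A ! i ! p = c} - {v}"
      by auto
    then have "card {p \<in> {..<length (A ! i)} - {v}. A ! i ! p = c} = Pi A i c - 1"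
      using True assms(4) by (simp add: Pi_def count_list_card)
    then show ?thesis using assms(3) True by (simp add: Om_def)
  next
    case False
    then have "{p \<in> {..<length (A ! i)} - {v}. A ! i ! p = c} = {p. p < length (A ! i) \<and> A ! i ! p = c}"
      by auto
    then show ?thesis using assms(1,2) that by (auto simp: ge_def Om_def Pi_def count_list_card)
  qed
qed (use that in auto)

text \<open>Two points of a transversal can be merged into \<open>\<tau> p q\<close>, the other points \<open>x\<close> being moved to
  \<open>\<tau> x x\<close>; hence a transversal of least size is a single point.\<close>

lemma transversal_collapse:
  fixes \<S> :: "'a set set" and \<tau> :: "'a \<Rightarrow> 'a \<Rightarrow> 'a"
  assumes "finite X" "\<And>S. S \<in> \<S> \<Longrightarrow> X \<inter> S \<noteq> {}" "\<S> \<noteq> {}"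
    and shift: "\<And>S. S \<in> \<S> \<Longrightarrow> \<exists>S'\<in>\<S>. \<forall>p\<in>X'. \<forall>q\<in>X'. p \<in> S' \<or> q \<in> S' \<longrightarrow> \<tau> p q \<in> S"
    and "\<And>S. S \<in> \<S> \<Longrightarrow> S \<subseteq> X'" "X \<subseteq> X'"
  shows "\<exists>v. \<forall>S\<in>\<S>. v \<in> S"
  using assms(1,2,6)
proof (induction "card X" arbitrary: X rule: less_induct)
  case less
  have "X \<noteq> {}" using less.prems \<open>\<S> \<noteq> {}\<close> by auto
  then obtain p where p: "p \<in> X" by blast
  show ?case
  proof (cases "X = {p}")
    case True then show ?thesis using less.prems(2) by auto
  next
    case False
    then obtain q where q: "q \<in> X" "q \<noteq> p" using p by blast
    define f where "f x = (if x = p \<or> x = q then \<tau> p q else \<tau> x x)" for x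
    have "f ` X = f ` (X - {q})" using p q by (auto simp: f_def image_iff)
    then have "card (f ` X) \<le> card (X - {q})" using less.prems(1) by (simp add: card_image_le)
    also have "\<dots> < card X" using q less.prems(1) by (simp add: card_gt_0_iff \<open>X \<noteq> {}\<close>)
    finally have c: "card (f ` X) < card X" .
    have hit: "(f ` X \<inter> X') \<inter> S \<noteq> {}" if S: "S \<in> \<S>" for S
    proof -
      obtain S' where S': "S' \<in> \<S>"
        "\<forall>p\<in>X'. \<forall>q\<in>X'. p \<in> S' \<or> q \<in> S' \<longrightarrow> \<tau> p q \<in> S" using shift[OF S] by blast
      obtain x where x: "x \<in> X" "x \<in> S'" using less.prems(2)[OF S'(1)] by blast
      \<comment> \<open>If \<open>x\<close> is \<open>p\<close> or \<open>q\<close>, one of the two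
        merged points lies in \<open>S'\<close>; otherwise the shift property is applied with both
        points equal to \<open>x\<close>.\<close>
      have "f x \<in> S" using S'(2) x p q less.prems(3) unfolding f_def by auto
      then show ?thesis using x assms(5)[OF S] by blast
    qed
    \<comment> \<open>The image may leave \<open>X'\<close>; cutting it back is harmless, since
      every member of the family lies in \<open>X'\<close>.\<close>
    have "card (f ` X \<inter> X') < card X"
      using c less.prems(1) by (meson card_mono finite_imageI inf_le1 le_less_trans)
    from less.hyps[OF this] show ?thesis using hit less.prems(1) by blast
  qed
qed

text \<open>Cells are even and junk locations (below) are odd, so the two never clash.\<close>

definition cell :: "nat \<Rightarrow> nat \<Rightarrow> nat \<Rightarrow> int" where
  "cell i p q = 2 * int (prod_encode (i, prod_encode (p, q))) + 2"

definition cells :: "(nat \<Rightarrow> (nat \<times> nat) set) \<Rightarrow> nat \<Rightarrow> int set" where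
  "cells G i = {cell i p q | p q. (p, q) \<in> G i}"

text \<open>A cell is common to both components of a binary remainder only if neither of the pieces
  holding it has been removed; hence the disjunction.\<close>

definition touched :: "(nat \<Rightarrow> (nat \<times> nat) set) \<Rightarrow> nat \<Rightarrow> nat set \<Rightarrow> int set" where
  "touched G i S = {cell i p q | p q. (p, q) \<in> G i \<and> (p \<in> S \<or> q \<in> S)}"

definition all_cells :: "nat list list \<Rightarrow> (nat \<Rightarrow> (nat \<times> nat) set) \<Rightarrow> int set" where
  "all_cells A G = (\<Union>i<length A. cells G i)"

text \<open>The locations still common to both heaps of the binary counterexample once the pieces of
  an embedding are removed.\<close>

definition residues ::
  "nat list list \<Rightarrow> nat list list \<Rightarrow> (nat \<Rightarrow> (nat \<times> nat) set) \<Rightarrow> nat \<Rightarrow> int set set" where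
  "residues A B G j =
     {all_cells A G - touched G i S | i S. i < length A \<and> embeds (B ! j) (A ! i) S}"

text \<open>\<open>H\<close> is the domain of a unary heap satisfying the left-hand side, and \<open>D (i, k)\<close> that of its part
  assigned to the variable at position \<open>k\<close> of conjunct \<open>i\<close>.\<close>

definition position ::
  "nat list list \<Rightarrow> (nat \<Rightarrow> (nat \<times> nat) set) \<Rightarrow> int set \<Rightarrow> (nat \<times> nat \<Rightarrow> int set) \<Rightarrow> bool" where
  "position A G H D \<longleftrightarrow> all_cells A G \<subseteq> H \<and>
     (\<forall>i<length A. \<forall>k<length (A ! i). D (i, k) \<subseteq> H \<and> D (i, k) \<inter> all_cells A G \<subseteq> cells G i \<and>
        (\<forall>k'<length (A ! i). k \<noteq> k' \<longrightarrow> D (i, k) \<inter> D (i, k') = {}))"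

text \<open>Unlike in \<open>embeds\<close>, positions may come from different conjuncts and may
  repeat; a repeated piece must be empty by the disjointness demanded in \<open>won\<close>.\<close>

definition picks :: "nat list list \<Rightarrow> nat list \<Rightarrow> (nat \<Rightarrow> nat \<times> nat) \<Rightarrow> bool" where
  "picks A bs s \<longleftrightarrow> (\<forall>k<length bs. fst (s k) < length A \<and>
     snd (s k) < length (A ! fst (s k)) \<and> A ! fst (s k) ! snd (s k) = bs ! k)"

text \<open>The last clause is the assertion of disjunct \<open>j\<close> read in a single heap: the
  remainder has a location outside each residue.\<close>

definition won ::
  "nat list list \<Rightarrow> nat list list \<Rightarrow> (nat \<Rightarrow> (nat \<times> nat) set) \<Rightarrow> int set \<Rightarrow>
    (nat \<times> nat \<Rightarrow> int set) \<Rightarrow> bool" where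
  "won A B G H D \<longleftrightarrow> (\<exists>j<length B. \<exists>s. picks A (B ! j) s \<and>
     (\<forall>k<length (B ! j). \<forall>k'<length (B ! j). k \<noteq> k' \<longrightarrow>
        D (s k) \<inter> D (s k') = {}) \<and>
     (\<forall>R\<in>residues A B G j. \<not> H - (\<Union>k<length (B ! j). D (s k)) \<subseteq> R))"

lemma cell_eq_iff [simp]: "cell i p q = cell i' p' q' \<longleftrightarrow> i = i' \<and> p = p' \<and> q = q'"
  by (simp add: cell_def)

lemma touched_subset: "touched G i S \<subseteq> cells G i"
  by (auto simp: touched_def cells_def)

lemma cells_disjoint: "i \<noteq> i' \<Longrightarrow> cells G i \<inter> cells G i' = {}"
  by (auto simp: cells_def)

lemma cells_subset: "i < length A \<Longrightarrow> cells G i \<subseteq> all_cells A G"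
  by (auto simp: all_cells_def)

section \<open>Consequences of a loss, for arbitrary cells\<close>

locale lost_position =
  fixes A B :: "nat list list" and G :: "nat \<Rightarrow> (nat \<times> nat) set"
    and H :: "int set" and D :: "nat \<times> nat \<Rightarrow> int set"
  assumes B_vars: "\<forall>j<length B. set (B ! j) \<subseteq> Vset A"
    and position: "position A G H D"
    and lost: "\<not> won A B G H D"
begin

text \<open>A variable with an empty piece can be served by that piece arbitrarily often.\<close>

definition spare :: "nat set" where
  "spare = {A ! i ! k | i k. i < length A \<and> k < length (A ! i) \<and> D (i, k) = {}}"

lemma pieces_disjoint:
  "i < length A \<Longrightarrow> k < length (A ! i) \<Longrightarrow> k' < length (A ! i) \<Longrightarrow> k \<noteq> k' \<Longrightarrow> D (i, k) \<inter> D (i, k') = {}"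
  and piece_cells:
  "i < length A \<Longrightarrow> k < length (A ! i) \<Longrightarrow> D (i, k) \<inter> all_cells A G \<subseteq> cells G i"
  and piece_subset: "i < length A \<Longrightarrow> k < length (A ! i) \<Longrightarrow> D (i, k) \<subseteq> H"
  and all_cells_subset: "all_cells A G \<subseteq> H"
  using position unfolding position_def by simp_all

lemma lost_pick:
  assumes "j < length B" "picks A (B ! j) s"
    "\<And>k k'. k < length (B ! j) \<Longrightarrow> k' < length (B ! j) \<Longrightarrow> k \<noteq> k' \<Longrightarrow>
        D (s k) \<inter> D (s k') = {}"
  obtains i S where "i < length A" "embeds (B ! j) (A ! i) S"
    "H - (\<Union>k<length (B ! j). D (s k)) \<subseteq> all_cells A G - touched G i S"
proof -
  let ?R = "H - (\<Union>k<length (B ! j). D (s k))"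
  have "won A B G H D" if "\<And>R. R \<in> residues A B G j \<Longrightarrow> \<not> ?R \<subseteq> R"
    unfolding won_def using assms that by (intro exI[of _ j] exI[of _ s] conjI) auto
  with lost obtain R where "R \<in> residues A B G j" "?R \<subseteq> R" by metis
  then show thesis using that unfolding residues_def by auto
qed

text \<open>Variables in \<open>spare\<close> are served by empty pieces, the others injectively
  from positions in \<open>P\<close>. This pick removes at most the pieces at \<open>P\<close>, so
  what is left without them lies in a residue.\<close>

lemma lost_partial:
  assumes "j < length B" "i < length A" and P: "P \<subseteq> {..<length (A ! i)}"
    and le: "\<And>c. c \<in> set (B ! j) - spare \<Longrightarrow> Om B j c \<le> card {p\<in>P. A ! i ! p = c}"
  obtains i' S' where "i' < length A" "embeds (B ! j) (A ! i') S'"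
    "H - (\<Union>k\<in>P. D (i, k)) \<subseteq> all_cells A G - touched G i' S'"
proof -
  let ?bs = "B ! j"
  let ?K = "{k. k < length ?bs \<and> ?bs ! k \<notin> spare}"
  have "\<forall>c\<in>spare. \<exists>r. fst r < length A \<and> snd r < length (A ! fst r) \<and>
      D r = {} \<and> A ! fst r ! snd r = c"
  proof
    fix c assume "c \<in> spare"
    then obtain i k where "c = A ! i ! k" "i < length A" "k < length (A ! i)" "D (i, k) = {}"
      unfolding spare_def by blast
    then show "\<exists>r. fst r < length A \<and> snd r < length (A ! fst r) \<and>
      D r = {} \<and> A ! fst r ! snd r = c" by (intro exI[of _ "(i, k)"]) simp
  qed
  from bchoice[OF this] obtain r where r: "\<And>c. c \<in> spare \<Longrightarrow> fst (r c) < length A \<and>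
      snd (r c) < length (A ! fst (r c)) \<and> D (r c) = {} \<and> A ! fst (r c) ! snd (r c) = c"
    by blast
  have "finite P" and finK: "finite ?K" using P finite_subset by auto
  have "card {k \<in> ?K. ?bs ! k = c} \<le> card {p \<in> P. A ! i ! p = c}"
    if c: "c \<in> (!) ?bs ` ?K" for c
  proof -
    have "{k \<in> ?K. ?bs ! k = c} = {k. k < length ?bs \<and> ?bs ! k = c}" using c by auto
    moreover have "c \<in> set ?bs - spare" using c by auto
    ultimately show ?thesis using le[of c] by (simp add: Om_def count_list_card)
  qed
  from colour_matching[OF finK \<open>finite P\<close> this]
  obtain s where s: "inj_on s ?K" "s ` ?K \<subseteq> P"
    "\<forall>k\<in>?K. A ! i ! s k = ?bs ! k" by blast
  define t where "t k = (if ?bs ! k \<in> spare then r (?bs ! k) else (i, s k))" for k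
  have empty: "D (t k) = {}" if "?bs ! k \<in> spare" for k
    using r[OF that] that by (simp add: t_def)
  have full: "t k = (i, s k)" "s k \<in> P" "s k < length (A ! i)"
    if "k < length ?bs" "?bs ! k \<notin> spare" for k
    using that s(2) P by (auto simp: t_def)
  have picks: "picks A ?bs t"
    unfolding picks_def
  proof (intro allI impI)
    fix k assume "k < length ?bs"
    then show "fst (t k) < length A \<and> snd (t k) < length (A ! fst (t k)) \<and>
        A ! fst (t k) ! snd (t k) = ?bs ! k"
      using r[of "?bs ! k"] s(3) full[of k] assms(2)
      by (cases "?bs ! k \<in> spare") (auto simp: t_def)
  qed
  have "D (t k) \<inter> D (t k') = {}"
    if "k < length ?bs" "k' < length ?bs" "k \<noteq> k'" for k k'
  proof (cases "?bs ! k \<in> spare \<or> ?bs ! k' \<in> spare")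
    case False
    then have "s k \<noteq> s k'" using that s(1) by (auto simp: inj_on_def)
    then show ?thesis using full that False pieces_disjoint[OF assms(2)] by simp
  qed (use empty in auto)
  from lost_pick[OF assms(1) picks this] obtain i' S'
    where *: "i' < length A" "embeds ?bs (A ! i') S'"
    "H - (\<Union>k<length ?bs. D (t k)) \<subseteq> all_cells A G - touched G i' S'" .
  have "D (t k) \<subseteq> (\<Union>k\<in>P. D (i, k))" if "k < length ?bs" for k
    using empty[of k] full[of k] that by (cases "?bs ! k \<in> spare") auto
  then have "(\<Union>k<length ?bs. D (t k)) \<subseteq> (\<Union>k\<in>P. D (i, k))" by (intro UN_least) auto
  then have "H - (\<Union>k\<in>P. D (i, k)) \<subseteq> all_cells A G - touched G i' S'"
    using *(3) by (meson Diff_mono order_refl order_trans)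
  then show thesis using that *(1,2) by simp
qed

text \<open>Here \<open>P\<close> is the embedding itself; all cells touched by the new embedding
  must then lie in the pieces of \<open>S\<close>.\<close>

lemma lost_single:
  assumes "j < length B" "i < length A" "embeds (B ! j) (A ! i) S"
  obtains i' S' where "i' < length A" "embeds (B ! j) (A ! i') S'"
    "H - (\<Union>k\<in>S. D (i, k)) \<subseteq> all_cells A G - touched G i' S'"
proof (rule lost_partial[OF assms(1,2) embeds_bound[OF assms(3)]])
  obtain s where s: "inj_on s {..<length (B ! j)}" "S = s ` {..<length (B ! j)}"
    "\<forall>k<length (B ! j). s k < length (A ! i) \<and> A ! i ! s k = B ! j ! k"
    using assms(3) unfolding embeds_def by blast
  then have "card {k. k < length (B ! j) \<and> B ! j ! k = c} \<le> card {p \<in> S. A ! i ! p = c}" for c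
    by (intro card_inj_on_le[of s]) (auto simp: inj_on_def)
  then show "Om B j c \<le> card {p \<in> S. A ! i ! p = c}" for c by (simp add: Om_def count_list_card)
qed (use that in auto)

text \<open>Here all pieces of conjunct \<open>i\<close> may be spent. This applies when every
  variable obstructing an embedding of disjunct \<open>j\<close> into it is in
  \<open>spare\<close>.\<close>

lemma lost_mixed:
  assumes "j < length B" "i < length A"
    "\<And>c. c \<in> set (B ! j) - spare \<Longrightarrow> Om B j c \<le> Pi A i c"
  obtains i' S' where "i' < length A" "embeds (B ! j) (A ! i') S'"
    "H - (\<Union>k<length (A ! i). D (i, k)) \<subseteq> all_cells A G - touched G i' S'"
  by (rule lost_partial[OF assms(1,2), of "{..<length (A ! i)}"])
    (use assms(3) that in \<open>auto simp: Pi_def count_list_card\<close>)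

lemma lost_empty:
  assumes "j < length B" "set (B ! j) \<subseteq> spare" "A \<noteq> []"
  obtains i S where "i < length A" "embeds (B ! j) (A ! i) S" "H \<subseteq> all_cells A G - touched G i S"
  by (rule lost_partial[OF assms(1), of 0 "{}"]) (use assms that in auto)

text \<open>An unbalanced variable has a surplus in some conjunct, so some embedding avoids a
  position \<open>v\<close> of it. The piece at \<open>v\<close> survives in the remainder and thus
  consists of cells; containing none by \<open>clean\<close>, it is empty.\<close>

lemma nonempty_balanced:
  assumes "c \<in> Vset A - spare"
    and nonempty: "\<And>l. l < length B \<Longrightarrow> B ! l \<noteq> []"
    and clean: "\<And>i l S v. i < length A \<Longrightarrow> l < length B \<Longrightarrow> B ! l \<noteq> [] \<Longrightarrow> embeds (B ! l) (A ! i) S \<Longrightarrow>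
      v < length (A ! i) \<Longrightarrow> v \<notin> S \<Longrightarrow> D (i, v) \<inter> all_cells A G = {}"
  shows "balanced_at A B c"
proof (rule ccontr)
  assume "\<not> balanced_at A B c"
  then obtain k l where kl: "k < length A" "l < length B" "ge A B k l" "Pi A k c \<noteq> Om B l c"
    by (auto simp: balanced_at_def Lset_def)
  then have lt: "Om B l c < Pi A k c" using assms(1) by (fastforce simp: ge_def)
  then have "c \<in> set (A ! k)" using count_notin[of c "A ! k"] unfolding Pi_def by (metis less_nat_zero_code)
  then obtain v where v: "v < length (A ! k)" "A ! k ! v = c" by (auto simp: in_set_conv_nth)
  obtain S where S: "embeds (B ! l) (A ! k) S" "v \<notin> S"
    using embeds_avoiding[OF kl(3), of v] B_vars kl(2) lt v by auto
  obtain i' S' where "H - (\<Union>k'\<in>S. D (k, k')) \<subseteq> all_cells A G - touched G i' S'"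
    using lost_single[OF kl(2,1) S(1)] by blast
  moreover have "D (k, v) \<inter> D (k, k') = {}" if "k' \<in> S" for k'
    using pieces_disjoint[OF kl(1) v(1), of k'] S that embeds_bound[OF S(1)] by auto
  moreover have "D (k, v) \<subseteq> H" using piece_subset kl(1) v(1) by simp
  ultimately have "D (k, v) \<subseteq> all_cells A G" by blast
  then have "D (k, v) = {}" using clean[OF kl(1,2) nonempty[OF kl(2)] S(1) v(1) S(2)] by blast
  then have "c \<in> spare" using kl v unfolding spare_def by blast
  then show False using assms(1) by blast
qed

text \<open>The witnesses for both clauses of (Shadow) are variables outside \<open>spare\<close>,
  which are balanced by \<open>nonempty_balanced\<close>.\<close>

lemma shadow_if:
  assumes "\<And>l. l < length B \<Longrightarrow> B ! l \<noteq> []"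
    and "\<And>i l S v. i < length A \<Longrightarrow> l < length B \<Longrightarrow> B ! l \<noteq> [] \<Longrightarrow> embeds (B ! l) (A ! i) S \<Longrightarrow>
      v < length (A ! i) \<Longrightarrow> v \<notin> S \<Longrightarrow> D (i, v) \<inter> all_cells A G = {}"
    and "\<And>i j. i < length A \<Longrightarrow> j < length B \<Longrightarrow> \<not> ge A B i j \<Longrightarrow> \<exists>c\<in>set (B ! j) - spare. Pi A i c < Om B j c"
    and "\<And>j. j < length B \<Longrightarrow> B ! j \<noteq> [] \<Longrightarrow> \<not> set (B ! j) \<subseteq> spare"
  shows "shadow A B"
proof -
  have bal: "balanced_at A B c" if "c \<in> Vset A - spare" for c
    by (rule nonempty_balanced[OF that]) (use assms(1,2) in blast)+
  have "\<exists>c\<in>Vset A. Pi A i c < Om B j c \<and> balanced_at A B c"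
    if "i < length A" "j < length B" "\<not> ge A B i j" for i j
    using assms(3)[OF that] bal B_vars that(2) by blast
  moreover have "\<exists>c\<in>Vset A. Om B j c > 0 \<and> balanced_at A B c" if j: "j < length B" for j
  proof -
    obtain c where c: "c \<in> set (B ! j)" "c \<notin> spare" using assms(4)[OF j assms(1)[OF j]] by blast
    then have "c \<in> Vset A - spare" using B_vars j by blast
    moreover have "Om B j c > 0" using c(1) count_list_0_iff[of "B ! j" c] by (auto simp: Om_def)
    ultimately show ?thesis using bal by blast
  qed
  ultimately show ?thesis by (auto simp: shadow_def Lset_def)
qed

end

section \<open>The choice of cells\<close>

definition unary_winning ::
  "nat list list \<Rightarrow> nat list list \<Rightarrow> (nat \<Rightarrow> (nat \<times> nat) set) \<Rightarrow> bool" where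
  "unary_winning A B G \<longleftrightarrow> (\<forall>H D. position A G H D \<longrightarrow> won A B G H D)"

text \<open>Variable-free disjuncts are left out: they embed with \<open>S\<close> empty and would
  rule out any common position.\<close>

definition embeddings :: "nat list list \<Rightarrow> nat list list \<Rightarrow> nat \<Rightarrow> nat set set" where
  "embeddings A B i = {S. \<exists>j<length B. B ! j \<noteq> [] \<and> embeds (B ! j) (A ! i) S}"

text \<open>The cell for \<open>(v, v)\<close> is touched by every embedding. Without a common
  position all pairs are taken, since merging \<open>p\<close> and \<open>q\<close> as in
  \<open>transversal_collapse\<close> needs the cell for \<open>(p, q)\<close>.\<close>

definition cell_plan :: "nat list list \<Rightarrow> nat list list \<Rightarrow> nat \<Rightarrow> (nat \<times> nat) set" where
  "cell_plan A B i =
     (if embeddings A B i = {} then {}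
      else if \<exists>v. \<forall>S\<in>embeddings A B i. v \<in> S
        then (\<lambda>v. {(v, v)}) (SOME v. \<forall>S\<in>embeddings A B i. v \<in> S)
        else {..<length (A ! i)} \<times> {..<length (A ! i)})"

text \<open>Without cells all residues are empty, so in a lost position every admissible pick uses
  up \<open>H\<close>. As \<open>j1\<close> has no residue at all, a lost position admits no pick
  for it.\<close>

lemma unary_winning_trivial:
  assumes "A \<noteq> []" "\<forall>j<length B. set (B ! j) \<subseteq> Vset A" "\<not> shadow A B"
    and j1: "j1 < length B" "\<And>i. i < length A \<Longrightarrow> \<not> ge A B i j1"
    and "length A = 1 \<or> (\<exists>j<length B. B ! j = [])"
  shows "unary_winning A B (\<lambda>_. {})"
  unfolding unary_winning_def
proof (intro allI impI, rule ccontr)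
  fix H D assume "position A (\<lambda>_. {}) H D" "\<not> won A B (\<lambda>_. {}) H D"
  then interpret lost_position A B "\<lambda>_. {}" H D by unfold_locales (use assms in auto)
  have no_cells: "all_cells A (\<lambda>_. {}) = {}" by (simp add: all_cells_def cells_def)
  have not_spare: False if j: "j < length B" "set (B ! j) \<subseteq> spare" for j
  proof -
    \<comment> \<open>A disjunct served by empty pieces forces \<open>H\<close> to be empty; then
      every variable is in \<open>spare\<close> and \<open>j1\<close> can be served too.\<close>
    have "H = {}" using lost_empty[OF j \<open>A \<noteq> []\<close>] no_cells by (metis Diff_empty empty_Diff subset_empty)
    then have "Vset A \<subseteq> spare"
      unfolding Vset_def spare_def using piece_subset by (fastforce simp: in_set_conv_nth)
    then have "set (B ! j1) \<subseteq> spare" using assms(2) j1(1) by blast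
    then obtain i S where "i < length A" "embeds (B ! j1) (A ! i) S"
      using lost_empty[OF j1(1) _ \<open>A \<noteq> []\<close>] by metis
    then show False using j1 assms(2) ge_iff_embeds by blast
  qed
  have nonempty: "B ! j \<noteq> []" if "j < length B" for j using not_spare[OF that] by auto
  then have M: "length A = 1" using assms(6) by blast
  have "shadow A B"
  proof (rule shadow_if)
    fix i j assume ij: "i < length A" "j < length B" "\<not> ge A B i j"
    show "\<exists>c\<in>set (B ! j) - spare. Pi A i c < Om B j c"
    proof (rule ccontr)
      assume "\<not> ?thesis"
      then have "\<And>c. c \<in> set (B ! j) - spare \<Longrightarrow> Om B j c \<le> Pi A i c" by (meson not_le)
      from lost_mixed[OF ij(2,1) this] obtain i' S' where "i' < length A" "embeds (B ! j) (A ! i') S'"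
        by metis
      \<comment> \<open>With one conjunct, \<open>i'\<close> and \<open>i\<close> coincide, so the
        embedding contradicts the failure of \<open>ge\<close>.\<close>
      then show False using ij M assms(2) ge_iff_embeds by (metis less_one)
    qed
  qed (use nonempty not_spare no_cells in auto)
  then show False using assms(3) by blast
qed

lemma cell_plan_common:
  assumes "embeddings A B i \<noteq> {}" "\<exists>v. \<forall>S\<in>embeddings A B i. v \<in> S"
  obtains v where "\<forall>S\<in>embeddings A B i. v \<in> S" "cell_plan A B i = {(v, v)}"
  using someI_ex[OF assms(2)] assms by (simp add: cell_plan_def)

lemma cell_plan_full:
  assumes "embeddings A B i \<noteq> {}" "\<not> (\<exists>v. \<forall>S\<in>embeddings A B i. v \<in> S)"
  shows "cell_plan A B i = {..<length (A ! i)} \<times> {..<length (A ! i)}"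
  unfolding cell_plan_def using assms by (simp only: if_False)

lemma cell_plan_bounded:
  assumes "(p, q) \<in> cell_plan A B i" shows "p < length (A ! i) \<and> q < length (A ! i)"
proof (cases "embeddings A B i \<noteq> {} \<and> (\<exists>v. \<forall>S\<in>embeddings A B i. v \<in> S)")
  case True
  then obtain v where v: "\<forall>S\<in>embeddings A B i. v \<in> S" "cell_plan A B i = {(v, v)}"
    using cell_plan_common[of A B i] by blast
  then have "v < length (A ! i)" using True embeds_bound by (fastforce simp: embeddings_def)
  with v show ?thesis using assms by simp
qed (use assms in \<open>auto simp: cell_plan_def split: if_splits\<close>)

text \<open>A diagonal cell at a position of \<open>S\<close> is always present. Hence every residue
  of a disjunct with variables misses a cell.\<close>

lemma touched_nonempty:
  assumes "S \<in> embeddings A B i" shows "touched (cell_plan A B) i S \<noteq> {}"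
proof -
  obtain j where "B ! j \<noteq> []" "embeds (B ! j) (A ! i) S" using assms by (auto simp: embeddings_def)
  then obtain p where p: "p \<in> S" "p < length (A ! i)"
    using embeds_nonempty embeds_bound by (metis all_not_in_conv lessThan_iff subsetD)
  show ?thesis
  proof (cases "\<exists>v. \<forall>S\<in>embeddings A B i. v \<in> S")
    case True
    then obtain v where "\<forall>S\<in>embeddings A B i. v \<in> S" "cell_plan A B i = {(v, v)}"
      using assms cell_plan_common[of A B i] by blast
    then show ?thesis using assms by (auto simp: touched_def)
  next
    case False
    then have "(p, p) \<in> cell_plan A B i" using cell_plan_full[OF _ False] assms p by auto
    then show ?thesis using p by (auto simp: touched_def)
  qed
qed

lemma sum_count_list:
  "finite W \<Longrightarrow> (\<Sum>c\<in>W. count_list xs c) = card {k. k < length xs \<and> xs ! k \<in> W}"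
proof -
  assume W: "finite W"
  have "(\<Sum>c\<in>W. count_list xs c) = length (filter (\<lambda>x. x \<in> W) xs)"
  proof (induction xs)
    case (Cons x xs)
    have "(\<Sum>c\<in>W. count_list (x # xs) c) = (\<Sum>c\<in>W. count_list xs c + (if x = c then 1 else 0))"
      by (intro sum.cong) auto
    also have "\<dots> = (\<Sum>c\<in>W. count_list xs c) + (if x \<in> W then 1 else 0)"
      using W by (simp add: sum.distrib)
    finally show ?case using Cons by simp
  qed simp
  then show ?thesis by (simp add: length_filter_conv_card)
qed

section \<open>Lost positions for the chosen cells\<close>

locale lost_plan = lost_position A B "cell_plan A B" H D for A B H D
begin

abbreviation "G \<equiv> cell_plan A B"

text \<open>The embedding \<open>S'\<close> from \<open>lost_single\<close> touches only cells
  removed with the pieces of \<open>S\<close>. Pieces of conjunct \<open>i\<close> hold no cells of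
  other conjuncts, so \<open>S'\<close> embeds into the same conjunct.\<close>

lemma touched_shift:
  assumes "i < length A" "S \<in> embeddings A B i"
  obtains S' where "S' \<in> embeddings A B i" "touched G i S' \<subseteq> (\<Union>k\<in>S. D (i, k))"
proof -
  obtain j where j: "j < length B" "B ! j \<noteq> []" "embeds (B ! j) (A ! i) S"
    using assms(2) by (auto simp: embeddings_def)
  obtain i' S' where *: "i' < length A" "embeds (B ! j) (A ! i') S'"
    "H - (\<Union>k\<in>S. D (i, k)) \<subseteq> all_cells A G - touched G i' S'"
    using lost_single[OF j(1) assms(1) j(3)] by metis
  have S': "S' \<in> embeddings A B i'" using j * by (auto simp: embeddings_def)
  have sub: "touched G i' S' \<subseteq> (\<Union>k\<in>S. D (i, k))"
    using *(3) touched_subset[of G i' S'] cells_subset[OF *(1), of G] all_cells_subset by blast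
  moreover have "i' = i"
  proof -
    obtain x where x: "x \<in> touched G i' S'" using touched_nonempty[OF S'] by blast
    then obtain k where "k \<in> S" "x \<in> D (i, k)" using sub by blast
    then have "x \<in> cells G i"
      using piece_cells[OF assms(1), of k] embeds_bound[OF j(3)] x touched_subset[of G i' S']
        cells_subset[OF *(1), of G] by blast
    then show ?thesis using cells_disjoint[of i i' G] x touched_subset[of G i' S'] by blast
  qed
  ultimately show thesis using S' that by blast
qed

text \<open>Without a common position all pairs are cells. Sending \<open>(p, q)\<close> to the
  piece holding its cell gives the merging map of \<open>transversal_collapse\<close>, with
  \<open>touched_shift\<close> as shift property, and the set of all positions collapses to a common
  one.\<close>

lemma common_piece:
  assumes "i < length A" "embeddings A B i \<noteq> {}"
  shows "\<exists>v. \<forall>S\<in>embeddings A B i. v \<in> S"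
proof (rule ccontr)
  let ?m = "{..<length (A ! i)}"
  assume no: "\<not> ?thesis"
  then have G: "G i = ?m \<times> ?m" using assms(2) by (intro cell_plan_full)
  have bound: "S \<subseteq> ?m" if "S \<in> embeddings A B i" for S
    using that embeds_bound by (auto simp: embeddings_def)
  \<comment> \<open>The value is arbitrary if the cell lies in no piece; the shift property concerns
    only cells touched by \<open>S'\<close>, which do lie in one.\<close>
  define \<tau> where "\<tau> p q = (SOME k. k \<in> ?m \<and> cell i p q \<in> D (i, k))" for p q
  have "\<exists>v. \<forall>S\<in>embeddings A B i. v \<in> S"
  proof (rule transversal_collapse[of ?m _ ?m \<tau>])
    show "?m \<inter> S \<noteq> {}" if "S \<in> embeddings A B i" for S
      using bound[OF that] embeds_nonempty that by (fastforce simp: embeddings_def)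
    fix S assume S: "S \<in> embeddings A B i"
    obtain S' where S': "S' \<in> embeddings A B i" "touched G i S' \<subseteq> (\<Union>k\<in>S. D (i, k))"
      using touched_shift[OF assms(1) S] by metis
    have "\<tau> p q \<in> S" if pq: "p \<in> ?m" "q \<in> ?m" "p \<in> S' \<or> q \<in> S'" for p q
    proof -
      have "cell i p q \<in> touched G i S'" using pq G by (auto simp: touched_def)
      then obtain k where k: "k \<in> S" "cell i p q \<in> D (i, k)" using S'(2) by blast
      have "\<tau> p q \<in> ?m \<and> cell i p q \<in> D (i, \<tau> p q)"
        unfolding \<tau>_def using someI[of "\<lambda>k. k \<in> ?m \<and> cell i p q \<in> D (i, k)" k] k bound[OF S] by blast
      then have "\<tau> p q = k" using pieces_disjoint[OF assms(1), of "\<tau> p q" k] k bound[OF S] by blast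
      then show ?thesis using k by simp
    qed
    then show "\<exists>S'\<in>embeddings A B i. \<forall>p\<in>?m. \<forall>q\<in>?m. p \<in> S' \<or> q \<in> S' \<longrightarrow> \<tau> p q \<in> S"
      using S'(1) by blast
  qed (use assms(2) bound in auto)
  then show False using no by blast
qed

text \<open>Every embedding touches the only cell of conjunct \<open>i\<close>, so by
  \<open>touched_shift\<close> the pieces of every embedding contain it. Disjointness makes this the
  same piece \<open>u\<close> each time; \<open>u\<close> may differ from \<open>v\<close>.\<close>

lemma carrier:
  assumes "i < length A" "embeddings A B i \<noteq> {}"
  obtains u where "u < length (A ! i)" "\<forall>S\<in>embeddings A B i. u \<in> S" "cells G i \<subseteq> D (i, u)"
proof -
  obtain v where v: "\<forall>S\<in>embeddings A B i. v \<in> S" and G: "G i = {(v, v)}"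
    by (rule cell_plan_common[OF assms(2) common_piece[OF assms]])
  have ex: "\<exists>k\<in>S. cell i v v \<in> D (i, k)" if S: "S \<in> embeddings A B i" for S
  proof -
    obtain S' where "S' \<in> embeddings A B i" "touched G i S' \<subseteq> (\<Union>k\<in>S. D (i, k))"
      using touched_shift[OF assms(1) S] by metis
    moreover from this v G have "cell i v v \<in> touched G i S'" by (auto simp: touched_def)
    ultimately show ?thesis by blast
  qed
  have bound: "S \<subseteq> {..<length (A ! i)}" if "S \<in> embeddings A B i" for S
    using that embeds_bound by (auto simp: embeddings_def)
  obtain S0 where S0: "S0 \<in> embeddings A B i" using assms(2) by blast
  obtain u where u: "u \<in> S0" "cell i v v \<in> D (i, u)" using ex[OF S0] by blast
  have "u \<in> S" if S: "S \<in> embeddings A B i" for S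
  proof -
    obtain k where k: "k \<in> S" "cell i v v \<in> D (i, k)" using ex[OF S] by blast
    then have "k = u" using pieces_disjoint[OF assms(1), of k u] u bound[OF S] bound[OF S0] by blast
    then show ?thesis using k by simp
  qed
  moreover have "cells G i = {cell i v v}" using G by (auto simp: cells_def)
  moreover have "u < length (A ! i)" using u(1) bound[OF S0] by auto
  ultimately show thesis using that[of u] u(2) by simp
qed

lemma piece_without_cells:
  assumes "i < length A" "S \<in> embeddings A B i" "v < length (A ! i)" "v \<notin> S"
  shows "D (i, v) \<inter> all_cells A G = {}"
proof -
  obtain u where "u < length (A ! i)" "\<forall>S\<in>embeddings A B i. u \<in> S" "cells G i \<subseteq> D (i, u)"
    using carrier[OF assms(1)] assms(2) by blast
  then show ?thesis
    using piece_cells[OF assms(1,3)] pieces_disjoint[OF assms(1,3), of u] assms(2,4) by blast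
qed

text \<open>Otherwise \<open>lost_mixed\<close> yields an embedding into another conjunct, whose
  touched cells would have to lie in pieces of conjunct \<open>i\<close>.\<close>

lemma witness_outside_spare:
  assumes "i < length A" "j < length B" "\<not> ge A B i j"
  shows "\<exists>c\<in>set (B ! j) - spare. Pi A i c < Om B j c"
proof (rule ccontr)
  assume "\<not> ?thesis"
  then have "\<And>c. c \<in> set (B ! j) - spare \<Longrightarrow> Om B j c \<le> Pi A i c" by (meson not_le)
  from lost_mixed[OF assms(2,1) this] obtain i' S'
    where *: "i' < length A" "embeds (B ! j) (A ! i') S'"
    "H - (\<Union>k<length (A ! i). D (i, k)) \<subseteq> all_cells A G - touched G i' S'" by metis
  have "B ! j \<noteq> []" using assms(3) by (auto simp: ge_def Om_def)
  then have "S' \<in> embeddings A B i'" using * assms(2) by (auto simp: embeddings_def)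
  then obtain x where x: "x \<in> touched G i' S'" using touched_nonempty by blast
  then have x': "x \<in> cells G i'" "x \<in> all_cells A G" "x \<in> H"
    using touched_subset[of G i' S'] cells_subset[OF *(1), of G] all_cells_subset by blast+
  have "i' \<noteq> i" using assms *(2) B_vars ge_iff_embeds by blast
  then have "x \<notin> D (i, k)" if "k < length (A ! i)" for k
    using piece_cells[OF assms(1) that] x' cells_disjoint[of i i' G] by blast
  then show False using *(3) x x' by blast
qed

text \<open>Empty pieces would remove nothing, yet a touched cell has to be removed.\<close>

lemma not_subset_spare:
  assumes "j < length B" "B ! j \<noteq> []" "A \<noteq> []" shows "\<not> set (B ! j) \<subseteq> spare"
proof
  assume "set (B ! j) \<subseteq> spare"
  from lost_empty[OF assms(1) this assms(3)] obtain i S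
    where *: "i < length A" "embeds (B ! j) (A ! i) S" "H \<subseteq> all_cells A G - touched G i S" by metis
  then have "S \<in> embeddings A B i" using assms by (auto simp: embeddings_def)
  from touched_nonempty[OF this] show False
    using *(3) touched_subset[of G i S] cells_subset[OF *(1), of G] all_cells_subset by blast
qed

lemma shadow_if_nonempty:
  assumes "A \<noteq> []" "\<And>l. l < length B \<Longrightarrow> B ! l \<noteq> []"
  shows "shadow A B"
proof (rule shadow_if)
  fix i l S v assume "i < length A" "l < length B" "B ! l \<noteq> []" "embeds (B ! l) (A ! i) S"
    "v < length (A ! i)" "v \<notin> S"
  then show "D (i, v) \<inter> all_cells A G = {}"
    by (intro piece_without_cells[of i S v]) (auto simp: embeddings_def)
qed (use assms witness_outside_spare not_subset_spare in auto)

text \<open>The balloon is \<open>Vset A - spare\<close>. As \<open>H\<close> consists of cells, a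
  nonempty piece holds a cell of its conjunct, and these all lie in one piece; so at most one
  position per conjunct has a variable outside \<open>spare\<close>.\<close>

lemma balloon_if:
  assumes "A \<noteq> []" "H \<subseteq> all_cells A G" "\<And>j. j < length B \<Longrightarrow> \<exists>i<length A. ge A B i j"
  shows "balloon A B"
proof -
  let ?W = "Vset A - spare"
  have fin: "finite ?W" by (simp add: Vset_def)
  have unique: "\<exists>u. \<forall>k<length (A ! i). A ! i ! k \<in> ?W \<longrightarrow> k = u" if i: "i < length A" for i
  proof -
    have full: "cells G i \<inter> D (i, k) \<noteq> {}" if k: "k < length (A ! i)" "A ! i ! k \<in> ?W" for k
    proof -
      have "D (i, k) \<noteq> {}" using k i unfolding spare_def by blast
      then show ?thesis using piece_cells[OF i k(1)] piece_subset[OF i k(1)] assms(2) by blast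
    qed
    show ?thesis
    proof (cases "embeddings A B i = {}")
      case True
      then have "cells G i = {}" by (simp add: cells_def cell_plan_def)
      then show ?thesis using full by blast
    next
      case False
      then obtain u where u: "u < length (A ! i)" "cells G i \<subseteq> D (i, u)" using carrier[OF i] by metis
      have "k = u" if k: "k < length (A ! i)" "A ! i ! k \<in> ?W" for k
        using full[OF k] u pieces_disjoint[OF i k(1) u(1)] by blast
      then show ?thesis by blast
    qed
  qed
  have le1: "(\<Sum>c\<in>?W. Pi A i c) \<le> 1" if i: "i < length A" for i
  proof -
    obtain u where "\<forall>k<length (A ! i). A ! i ! k \<in> ?W \<longrightarrow> k = u" using unique[OF i] by blast
    then have "{k. k < length (A ! i) \<and> A ! i ! k \<in> ?W} \<subseteq> {u}" by blast
    then have "card {k. k < length (A ! i) \<and> A ! i ! k \<in> ?W} \<le> card {u}" by (intro card_mono) auto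
    then show ?thesis using sum_count_list[OF fin] by (simp add: Pi_def)
  qed
  \<comment> \<open>At least 1 by \<open>not_subset_spare\<close>, at most 1 by comparison with a
    conjunct into which the disjunct embeds.\<close>
  have eq1: "(\<Sum>c\<in>Vset A. Om B j c) = 0 \<or> (\<Sum>c\<in>?W. Om B j c) = 1" if j: "j < length B" for j
  proof (cases "B ! j = []")
    case False
    obtain c where c: "c \<in> set (B ! j)" "c \<in> ?W"
      using not_subset_spare[OF j False assms(1)] B_vars j by blast
    have "0 < Om B j c" using c(1) count_list_0_iff[of "B ! j" c] by (auto simp: Om_def)
    then have "(\<Sum>c\<in>?W. Om B j c) > 0" using c(2) fin by (metis sum_pos2 le0)
    moreover obtain i where i: "i < length A" "ge A B i j" using assms(3)[OF j] by blast
    have "(\<Sum>c\<in>?W. Om B j c) \<le> (\<Sum>c\<in>?W. Pi A i c)"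
      by (rule sum_mono) (use i(2) in \<open>auto simp: ge_def\<close>)
    ultimately show ?thesis using le1[OF i(1)] by linarith
  qed (simp add: Om_def)
  have "\<exists>c\<in>?W. Pi A i c < Om B j c" if "i < length A" "j < length B" "\<not> ge A B i j" for i j
    using witness_outside_spare[OF that] B_vars that(2) by blast
  then show ?thesis
    unfolding balloon_def Lset_def using le1 eq1 by (intro exI[of _ ?W]) auto
qed

end

text \<open>A variable-free disjunct costs nothing, so with one present a loss confines
  \<open>H\<close> to the cells and yields (Balloon); otherwise it yields (Shadow).\<close>

lemma unary_winning_cell_plan:
  assumes "A \<noteq> []" "\<forall>j<length B. set (B ! j) \<subseteq> Vset A" "\<not> shadow A B" "\<not> balloon A B"
    and "\<And>j0 j. j0 < length B \<Longrightarrow> B ! j0 = [] \<Longrightarrow> j < length B \<Longrightarrow> \<exists>i<length A. ge A B i j"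
  shows "unary_winning A B (cell_plan A B)"
  unfolding unary_winning_def
proof (intro allI impI, rule ccontr)
  fix H D assume "position A (cell_plan A B) H D" "\<not> won A B (cell_plan A B) H D"
  then interpret lost_plan A B H D by unfold_locales (use assms in auto)
  show False
  proof (cases "\<exists>j<length B. B ! j = []")
    case True
    then obtain j0 where j0: "j0 < length B" "B ! j0 = []" by blast
    then have "H \<subseteq> all_cells A G"
      using lost_empty[OF j0(1) _ assms(1)] by (metis Diff_subset empty_set empty_subsetI order_trans)
    then show ?thesis using balloon_if assms j0 by blast
  next
    case False
    then show ?thesis using shadow_if_nonempty assms by blast
  qed
qed

text \<open>Cells appear only with two or more conjuncts, since each must be kept by the assertion
  of a conjunct other than its own. The bounds make them finite in number.\<close>

lemma winning_plan_exists:
  assumes "A \<noteq> []" "\<forall>j<length B. set (B ! j) \<subseteq> Vset A"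
    and "\<not> shadow A B" "\<not> balloon A B" "\<not> lonely A B"
  obtains G where "unary_winning A B G" "length A \<ge> 2 \<or> G = (\<lambda>_. {})"
    "\<And>i p q. (p, q) \<in> G i \<Longrightarrow> p < length (A ! i) \<and> q < length (A ! i)"
proof (cases "length A = 1 \<or> (\<exists>j0<length B. B ! j0 = []) \<and> (\<exists>j<length B. \<forall>i<length A. \<not> ge A B i j)")
  case True
  \<comment> \<open>For a single conjunct, the failure of (Lonely) gives a disjunct that embeds
    nowhere.\<close>
  then have "\<exists>j<length B. \<forall>i<length A. \<not> ge A B i j"
    using assms(5) by (auto simp: lonely_def)
  then obtain j where "j < length B" "\<forall>i<length A. \<not> ge A B i j" by blast
  then have "unary_winning A B (\<lambda>_. {})"
    using unary_winning_trivial[OF assms(1-3)] True by blast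
  then show thesis using that by blast
next
  case False
  then have "unary_winning A B (cell_plan A B)"
    using unary_winning_cell_plan[OF assms(1-4)] by blast
  moreover have "length A \<ge> 2" using False assms(1) by (cases A) (auto simp: Suc_le_eq neq_Nil_conv)
  ultimately show thesis using that cell_plan_bounded by blast
qed

section \<open>The separating assertions\<close>

definition junk :: "nat \<Rightarrow> nat \<Rightarrow> nat \<Rightarrow> nat \<Rightarrow> int" where
  "junk i k i' k' = 2 * int (prod_encode (prod_encode (i, k), prod_encode (i', k'))) + 1"

text \<open>The case \<open>(i, k) = (i', k')\<close> provides a private location, which makes every piece nonempty and
  so prevents it from being used twice.\<close>

definition junk_of :: "nat list list \<Rightarrow> nat \<Rightarrow> nat \<Rightarrow> int set" where
  "junk_of A i k = (\<Union>i'<length A. \<Union>k'\<in>{k'. k' < length (A ! i') \<and> (i = i' \<longrightarrow> k = k')}.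
     {junk i k i' k', junk i' k' i k})"

definition zero_heap :: "int set \<Rightarrow> heap" where
  "zero_heap S = (\<lambda>x. if x \<in> S then Some 0 else None)"

text \<open>Junk enters the first component only: there it forces overlaps, and it is never common
  to both components.\<close>

definition piece1 :: "nat list list \<Rightarrow> (nat \<Rightarrow> (nat \<times> nat) set) \<Rightarrow> nat \<Rightarrow> nat \<Rightarrow> int set" where
  "piece1 A G i k = {cell i k q | q. (k, q) \<in> G i} \<union> junk_of A i k"

definition piece2 :: "(nat \<Rightarrow> (nat \<times> nat) set) \<Rightarrow> nat \<Rightarrow> nat \<Rightarrow> int set" where
  "piece2 G i k = {cell i p k | p. (p, k) \<in> G i}"

lemma dom_zero_heap [simp]: "dom (zero_heap S) = S"
  by (auto simp: zero_heap_def split: if_splits)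

lemma zero_heap_le [simp]: "zero_heap S \<subseteq>\<^sub>m zero_heap T \<longleftrightarrow> S \<subseteq> T"
  by (auto simp: map_le_def zero_heap_def split: if_splits)

lemma valid_zero_heap [simp]: "valid_heap (zero_heap S) \<longleftrightarrow> finite S \<and> S \<subseteq> {0<..}"
  by (simp add: valid_heap_def)

lemma junk_eq_iff [simp]:
  "junk i k i' k' = junk j l j' l' \<longleftrightarrow> i = j \<and> k = l \<and> i' = j' \<and> k' = l'"
  by (simp add: junk_def)

lemma junk_neq_cell [simp]: "junk i k i' k' \<noteq> cell j p q" "cell j p q \<noteq> junk i k i' k'"
  unfolding junk_def cell_def by presburger+

lemma junk_of_pos: "junk_of A i k \<subseteq> {0<..}"
  by (auto simp: junk_of_def junk_def)

lemma cells_pos: "cells G i \<subseteq> {0<..}"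
  by (auto simp: cells_def cell_def)

lemma finite_junk_of: "finite (junk_of A i k)"
  by (auto simp: junk_of_def)

lemma finite_cells:
  assumes "\<And>p q. (p, q) \<in> G i \<Longrightarrow> p < m \<and> q < m"
  shows "finite (cells G i)"
proof -
  have "cells G i \<subseteq> (\<lambda>(p, q). cell i p q) ` ({..<m} \<times> {..<m})"
    using assms by (fastforce simp: cells_def)
  then show ?thesis by (rule finite_subset) simp
qed

lemma piece1_disjoint: "k \<noteq> k' \<Longrightarrow> piece1 A G i k \<inter> piece1 A G i k' = {}"
  by (auto simp: piece1_def junk_of_def)

lemma piece2_disjoint: "k \<noteq> k' \<Longrightarrow> piece2 G i k \<inter> piece2 G i k' = {}"
  by (auto simp: piece2_def)

text \<open>The two share the junk indexed by both positions. Hence pieces with disjoint first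
  components stem from different positions of one conjunct.\<close>

lemma piece1_meets:
  assumes "i < length A" "k < length (A ! i)" "i' < length A" "k' < length (A ! i')"
    "i \<noteq> i' \<or> k = k'"
  shows "piece1 A G i k \<inter> piece1 A G i' k' \<noteq> {}"
proof -
  have "junk i k i' k' \<in> junk_of A i k"
    unfolding junk_of_def using assms by (intro UN_I[of i'] UN_I[of k']) auto
  moreover have "junk i k i' k' \<in> junk_of A i' k'"
    unfolding junk_of_def using assms by (intro UN_I[of i] UN_I[of k]) auto
  ultimately show ?thesis by (auto simp: piece1_def)
qed

lemma piece1_cells: "piece1 A G i k \<subseteq> cells G i \<union> junk_of A i k"
  by (auto simp: piece1_def cells_def)

lemma piece2_cells: "piece2 G i k \<subseteq> cells G i"
  by (auto simp: piece2_def cells_def)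

lemma junk_not_cell: "junk_of A i k \<inter> cells G j = {}"
  by (auto simp: junk_of_def cells_def)

text \<open>Only the meaning of the assertions enters, uniformly in \<open>n\<close>, so the same
  facts serve one heap and two.\<close>

locale separating =
  fixes A B :: "nat list list" and G :: "nat \<Rightarrow> (nat \<times> nat) set"
    and \<phi> \<psi> :: "nat \<Rightarrow> assn"
  assumes A: "A \<noteq> []"
    and two: "length A \<ge> 2 \<or> G = (\<lambda>_. {})"
    and bounded: "(p, q) \<in> G i \<Longrightarrow> p < length (A ! i) \<and> q < length (A ! i)"
    and sem_\<phi>: "sem n \<rho> (\<phi> i) \<eta> =
      {hs \<in> Heaps n. \<forall>x\<in>all_cells A G - cells G i. \<forall>h\<in>set hs. h x = Some 0}"
    and sem_\<psi>: "sem n \<rho> (\<psi> j) \<eta> =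
      {hs \<in> Heaps n. \<forall>R\<in>residues A B G j. \<exists>x v. x \<notin> R \<and> 0 < x \<and> (\<forall>h\<in>set hs. h x = Some v)}"
begin

section \<open>Validity of the unary implication\<close>

definition \<phi>s where "\<phi>s = map \<phi> [0..<length A]"
definition \<psi>s where "\<psi>s = map \<psi> [0..<length B]"

text \<open>Passing to domains turns a decomposition of the left-hand side into a position. Winning
  it returns pieces for some disjunct, with locations outside the residues as required by its
  assertion.\<close>

lemma unary_entails:
  assumes win: "unary_winning A B G"
  shows "entails 1 (lhs_of \<phi>s A) (rhs_of \<psi>s B)"
  unfolding entails_def
proof (intro allI impI subsetI)
  fix \<eta> \<rho> hs
  assume "\<forall>a. IRel 1 (\<rho> a)" and lhs: "hs \<in> sem 1 \<rho> (lhs_of \<phi>s A) \<eta>"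
  then have \<rho>: "\<rho> a \<subseteq> Heaps 1" for a by (auto simp: IRel_def)
  have \<phi>H: "sem 1 \<rho> (\<phi> i) \<eta> \<subseteq> Heaps 1" and \<psi>H: "sem 1 \<rho> (\<psi> i) \<eta> \<subseteq> Heaps 1" for i
    by (auto simp: sem_\<phi> sem_\<psi>)
  have hsH: "hs \<in> Heaps 1"
    and star: "\<And>i. i < length A \<Longrightarrow> hs \<in> sem 1 \<rho> (star_vars (\<phi> i) (A ! i)) \<eta>"
    using lhs by (auto simp: sem_lhs_of \<phi>s_def)
  obtain h where hs: "hs = [h]" and h: "valid_heap h"
    using hsH by (auto simp: Heaps_def length_Suc_conv)
  have "\<forall>i\<in>{..<length A}. \<exists>X. (\<forall>k<length (A ! i). X k \<in> \<rho> (A ! i ! k) \<and> ext_tuple (X k) hs) \<and>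
      (\<forall>k<length (A ! i). \<forall>k'<length (A ! i). k \<noteq> k' \<longrightarrow>
        (\<forall>l<1. dom (X k ! l) \<inter> dom (X k' ! l) = {})) \<and>
      rest 1 hs X (length (A ! i)) \<in> sem 1 \<rho> (\<phi> i) \<eta>"
    using star unfolding sem_star_vars[where \<rho> = \<rho>, OF \<rho> \<phi>H] by simp
  from bchoice[OF this] obtain X where X0: "\<forall>i\<in>{..<length A}.
      (\<forall>k<length (A ! i). X i k \<in> \<rho> (A ! i ! k) \<and> ext_tuple (X i k) hs) \<and>
      (\<forall>k<length (A ! i). \<forall>k'<length (A ! i). k \<noteq> k' \<longrightarrow>
        (\<forall>l<1. dom (X i k ! l) \<inter> dom (X i k' ! l) = {})) \<and>
      rest 1 hs (X i) (length (A ! i)) \<in> sem 1 \<rho> (\<phi> i) \<eta>" ..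
  then have X: "\<And>i k. i < length A \<Longrightarrow> k < length (A ! i) \<Longrightarrow> X i k \<in> \<rho> (A ! i ! k) \<and> ext_tuple (X i k) hs"
    "\<And>i k k'. i < length A \<Longrightarrow> k < length (A ! i) \<Longrightarrow> k' < length (A ! i) \<Longrightarrow> k \<noteq> k' \<Longrightarrow>
      dom (X i k ! 0) \<inter> dom (X i k' ! 0) = {}"
    "\<And>i. i < length A \<Longrightarrow> rest 1 hs (X i) (length (A ! i)) \<in> sem 1 \<rho> (\<phi> i) \<eta>"
    by simp_all
  define D where "D r = dom (X (fst r) (snd r) ! 0)" for r
  \<comment> \<open>The assertion of conjunct \<open>i\<close> keeps the cells of the others in the
    remainder, so no piece of \<open>i\<close> contains them.\<close>
  have own: "h x = Some 0 \<and> (\<forall>k<length (A ! i). x \<notin> D (i, k))"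
    if "i < length A" "x \<in> all_cells A G" "x \<notin> cells G i" for i x
  proof -
    have "(h |` (- (\<Union>k<length (A ! i). D (i, k)))) x = Some 0"
      using X(3)[OF that(1)] that(2,3) unfolding sem_\<phi> by (simp add: rest_def hs D_def)
    then show ?thesis by (auto simp: restrict_map_def split: if_splits)
  qed
  have cells_h: "x \<in> dom h" if x: "x \<in> all_cells A G" for x
  proof -
    obtain i where i: "i < length A" "x \<in> cells G i" using x by (auto simp: all_cells_def)
    \<comment> \<open>A cell is kept only by the assertions of other conjuncts, so its presence in
      \<open>h\<close> is obtained from a second conjunct.\<close>
    then have "length A \<ge> 2" using two by (auto simp: cells_def)
    then obtain i' where "i' < length A" "i' \<noteq> i"
      by (intro that[of "if i = 0 then 1 else 0"]) auto
    moreover from this have "x \<notin> cells G i'" using i cells_disjoint[of i i' G] by blast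
    ultimately show ?thesis using own[of i' x] x by auto
  qed
  have Dh: "D (i, k) \<subseteq> dom h" if "i < length A" "k < length (A ! i)" for i k
    using X(1)[OF that] by (simp add: D_def hs ext_tuple_iff_nth map_le_implies_dom_le)
  have "position A G (dom h) D"
    unfolding position_def
  proof (intro conjI allI impI)
    show "all_cells A G \<subseteq> dom h" using cells_h by blast
    fix i k assume ik: "i < length A" "k < length (A ! i)"
    show "D (i, k) \<subseteq> dom h" by (rule Dh[OF ik])
    show "D (i, k) \<inter> all_cells A G \<subseteq> cells G i" using own[OF ik(1)] ik(2) by blast
    fix k' assume "k' < length (A ! i)" "k \<noteq> k'"
    then show "D (i, k) \<inter> D (i, k') = {}" using X(2)[OF ik] by (simp add: D_def)
  qed
  then have "won A B G (dom h) D" using win by (simp add: unary_winning_def)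
  then obtain j s where j: "j < length B" and s: "picks A (B ! j) s"
    "\<forall>k<length (B ! j). \<forall>k'<length (B ! j). k \<noteq> k' \<longrightarrow> D (s k) \<inter> D (s k') = {}"
    "\<forall>R\<in>residues A B G j. \<not> dom h - (\<Union>k<length (B ! j). D (s k)) \<subseteq> R"
    unfolding won_def by blast
  define Y where "Y k = X (fst (s k)) (snd (s k))" for k
  have DY: "D (s k) = dom (Y k ! 0)" for k by (simp add: D_def Y_def)
  have "Y k \<in> \<rho> (B ! j ! k) \<and> ext_tuple (Y k) hs" if "k < length (B ! j)" for k
    using s(1) X(1)[of "fst (s k)" "snd (s k)"] that by (simp add: picks_def Y_def)
  moreover have "rest 1 hs Y (length (B ! j)) \<in> sem 1 \<rho> (\<psi> j) \<eta>"
  proof -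
    have "\<exists>x v. x \<notin> R \<and> 0 < x \<and> (\<forall>g\<in>set (rest 1 hs Y (length (B ! j))). g x = Some v)"
      if R: "R \<in> residues A B G j" for R
    proof -
      obtain x where "x \<in> dom h - (\<Union>k<length (B ! j). D (s k))" "x \<notin> R"
        using s(3) R by (meson subsetI)
      then obtain v where x: "h x = Some v" "x \<notin> (\<Union>k<length (B ! j). D (s k))" "x \<notin> R"
        by auto
      moreover have "0 < x" using x(1) h by (auto simp: valid_heap_def)
      ultimately show ?thesis
        by (intro exI[of _ x] exI[of _ v]) (simp add: rest_def hs restrict_map_def DY)
    qed
    then show ?thesis unfolding sem_\<psi> using rest_in_Heaps[OF hsH] by simp
  qed
  ultimately have "hs \<in> sem 1 \<rho> (star_vars (\<psi> j) (B ! j)) \<eta>"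
    unfolding sem_star_vars[where \<rho> = \<rho>, OF \<rho> \<psi>H] using hsH s(2) by (intro conjI exI[of _ Y]) (simp_all add: DY)
  then show "hs \<in> sem 1 \<rho> (rhs_of \<psi>s B) \<eta>" using j by (auto simp: sem_rhs_of \<psi>s_def)
qed

section \<open>The binary counterexample\<close>

definition pair :: "nat \<Rightarrow> nat \<Rightarrow> heap list" where
  "pair i k = [zero_heap (piece1 A G i k), zero_heap (piece2 G i k)]"

text \<open>The upward closure of the pairs at the positions of \<open>c\<close>.\<close>

definition \<rho>2 :: "nat \<Rightarrow> heap list set" where
  "\<rho>2 c = {hs \<in> Heaps 2. \<exists>i k. i < length A \<and> k < length (A ! i) \<and> A ! i ! k = c \<and> ext_tuple (pair i k) hs}"

definition all_junk :: "int set" where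
  "all_junk = (\<Union>i<length A. \<Union>k<length (A ! i). junk_of A i k)"

definition hs2 :: "heap list" where
  "hs2 = [zero_heap (all_cells A G \<union> all_junk), zero_heap (all_cells A G)]"

lemma finite_all_cells: "finite (all_cells A G)"
  unfolding all_cells_def using bounded by (intro finite_UN_I finite_cells) auto

lemma hs2_Heaps: "hs2 \<in> Heaps 2"
proof -
  have "finite all_junk" "all_junk \<subseteq> {0<..}" "all_cells A G \<subseteq> {0<..}"
    using finite_junk_of junk_of_pos cells_pos by (fastforce simp: all_junk_def all_cells_def)+
  then show ?thesis using finite_all_cells by (simp add: hs2_def Heaps_def)
qed

lemma less_two: "(\<forall>l<2. P l) \<longleftrightarrow> P 0 \<and> P (Suc 0)"
  by (auto simp: less_2_cases_iff)

lemma pair_ext: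
  assumes "i < length A" "k < length (A ! i)"
  shows "ext_tuple (pair i k) hs2"
  using assms piece1_cells[of A G i k] piece2_cells[of G i k] cells_subset[OF assms(1), of G]
  by (auto simp: ext_tuple_def pair_def hs2_def all_junk_def)

lemma pair_Heaps:
  assumes "i < length A" "k < length (A ! i)"
  shows "pair i k \<in> Heaps 2"
proof -
  have c: "finite (cells G i)" using bounded by (intro finite_cells)
  have "finite (piece1 A G i k)" "finite (piece2 G i k)"
    using finite_subset[OF piece1_cells] finite_subset[OF piece2_cells] c finite_junk_of by blast+
  moreover have "piece1 A G i k \<subseteq> {0<..}" "piece2 G i k \<subseteq> {0<..}"
    using piece1_cells[of A G i k] piece2_cells[of G i k] cells_pos[of G i] junk_of_pos[of A i k] by blast+
  ultimately show ?thesis by (simp add: pair_def Heaps_def)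
qed

text \<open>The pairs of conjunct \<open>i\<close> are disjoint in both components and hold only
  junk and cells of \<open>i\<close>, so the remainder keeps all other cells.\<close>

lemma hs2_lhs: "hs2 \<in> sem 2 \<rho>2 (lhs_of \<phi>s A) \<eta>"
proof -
  have \<rho>: "\<rho>2 a \<subseteq> Heaps 2" for a by (auto simp: \<rho>2_def)
  have \<phi>H: "sem 2 \<rho>2 (\<phi> i) \<eta> \<subseteq> Heaps 2" for i by (auto simp: sem_\<phi>)
  have "hs2 \<in> sem 2 \<rho>2 (star_vars (\<phi> i) (A ! i)) \<eta>" if i: "i < length A" for i
  proof -
    have "pair i k \<in> \<rho>2 (A ! i ! k) \<and> ext_tuple (pair i k) hs2" if "k < length (A ! i)" for k
    proof
      have "ext_tuple (pair i k) (pair i k)" by (simp add: ext_tuple_iff_nth)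
      then show "pair i k \<in> \<rho>2 (A ! i ! k)" unfolding \<rho>2_def using pair_Heaps[OF i that] i that by blast
    qed (rule pair_ext[OF i that])
    moreover have "rest 2 hs2 (pair i) (length (A ! i)) \<in> sem 2 \<rho>2 (\<phi> i) \<eta>"
    proof -
      have "g x = Some 0" if x: "x \<in> all_cells A G" "x \<notin> cells G i"
        and g: "g \<in> set (rest 2 hs2 (pair i) (length (A ! i)))" for g x
      proof -
        have "x \<notin> junk_of A i k" for k
          using x(1) junk_not_cell[of A i k G] by (auto simp: all_cells_def)
        then have "x \<notin> piece1 A G i k" "x \<notin> piece2 G i k" for k
          using x(2) piece1_cells[of A G i k] piece2_cells[of G i k] by blast+
        then show ?thesis
          using g x(1) by (auto simp: rest_def hs2_def pair_def numeral_2_eq_2 zero_heap_def restrict_map_def)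
      qed
      then show ?thesis
        unfolding sem_\<phi> mem_Collect_eq
        by (intro conjI ballI rest_in_Heaps[OF hs2_Heaps]) (elim DiffE)
    qed
    ultimately show ?thesis
      unfolding sem_star_vars[where \<rho> = \<rho>2, OF \<rho> \<phi>H]
      using hs2_Heaps piece1_disjoint piece2_disjoint
      by (intro conjI exI[of _ "pair i"]) (simp_all add: less_two pair_def)
  qed
  then show ?thesis using hs2_Heaps by (simp add: sem_lhs_of \<phi>s_def)
qed

text \<open>Disjoint first components force the pieces of a disjunct to form an embedding into one
  conjunct. Its assertion then asks for a common location outside the residue, that is, a touched
  cell, but such a cell is gone from one component.\<close>

lemma hs2_not_rhs: "hs2 \<notin> sem 2 \<rho>2 (rhs_of \<psi>s B) \<eta>"
proof
  have \<rho>: "\<rho>2 a \<subseteq> Heaps 2" for a by (auto simp: \<rho>2_def)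
  have \<psi>H: "sem 2 \<rho>2 (\<psi> i) \<eta> \<subseteq> Heaps 2" for i by (auto simp: sem_\<psi>)
  assume "hs2 \<in> sem 2 \<rho>2 (rhs_of \<psi>s B) \<eta>"
  then obtain j where j: "j < length B" "hs2 \<in> sem 2 \<rho>2 (star_vars (\<psi> j) (B ! j)) \<eta>"
    by (auto simp: sem_rhs_of \<psi>s_def)
  let ?n = "length (B ! j)"
  obtain Y where Y: "\<forall>k<?n. Y k \<in> \<rho>2 (B ! j ! k) \<and> ext_tuple (Y k) hs2"
    "\<forall>k<?n. \<forall>k'<?n. k \<noteq> k' \<longrightarrow> (\<forall>l<2. dom (Y k ! l) \<inter> dom (Y k' ! l) = {})"
    "rest 2 hs2 Y ?n \<in> sem 2 \<rho>2 (\<psi> j) \<eta>"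
    using j(2) unfolding sem_star_vars[where \<rho> = \<rho>2, OF \<rho> \<psi>H] by blast
  have "\<forall>k\<in>{..<?n}. \<exists>r. fst r < length A \<and> snd r < length (A ! fst r) \<and>
      A ! fst r ! snd r = B ! j ! k \<and> ext_tuple (pair (fst r) (snd r)) (Y k)"
    using Y(1) by (fastforce simp: \<rho>2_def)
  from bchoice[OF this] obtain r where r: "\<And>k. k < ?n \<Longrightarrow> fst (r k) < length A \<and>
      snd (r k) < length (A ! fst (r k)) \<and> A ! fst (r k) ! snd (r k) = B ! j ! k \<and>
      ext_tuple (pair (fst (r k)) (snd (r k))) (Y k)" by auto
  have sub: "piece1 A G (fst (r k)) (snd (r k)) \<subseteq> dom (Y k ! 0)"
    "piece2 G (fst (r k)) (snd (r k)) \<subseteq> dom (Y k ! 1)" if "k < ?n" for k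
  proof -
    have "ext_tuple (pair (fst (r k)) (snd (r k))) (Y k)" using r[OF that] by blast
    then have "\<forall>l<2. pair (fst (r k)) (snd (r k)) ! l \<subseteq>\<^sub>m Y k ! l"
      by (auto simp: ext_tuple_iff_nth pair_def)
    then have "zero_heap (piece1 A G (fst (r k)) (snd (r k))) \<subseteq>\<^sub>m Y k ! 0"
      "zero_heap (piece2 G (fst (r k)) (snd (r k))) \<subseteq>\<^sub>m Y k ! 1"
      by (simp_all add: less_two pair_def)
    then show "piece1 A G (fst (r k)) (snd (r k)) \<subseteq> dom (Y k ! 0)"
      "piece2 G (fst (r k)) (snd (r k)) \<subseteq> dom (Y k ! 1)"
      by (metis dom_zero_heap map_le_implies_dom_le)+
  qed
  have same: "fst (r k) = fst (r k') \<and> snd (r k) \<noteq> snd (r k')"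
    if k: "k < ?n" "k' < ?n" "k \<noteq> k'" for k k'
  proof -
    have "dom (Y k ! 0) \<inter> dom (Y k' ! 0) = {}" using Y(2)[rule_format, of k k' 0] k by simp
    then show ?thesis
      using piece1_meets[of "fst (r k)" A "snd (r k)" "fst (r k')" "snd (r k')" G]
        r[OF k(1)] r[OF k(2)] sub(1)[OF k(1)] sub(1)[OF k(2)] by blast
  qed
  \<comment> \<open>The default 0 is for a variable-free disjunct, which embeds into any conjunct
    with \<open>S\<close> empty.\<close>
  define i where "i = (if ?n = 0 then 0 else fst (r 0))"
  have fst_r: "fst (r k) = i" if "k < ?n" for k
    using same[of k 0] that by (cases "k = 0") (auto simp: i_def)
  have i: "i < length A" using r[of 0] A by (auto simp: i_def)
  define S where "S = (\<lambda>k. snd (r k)) ` {..<?n}"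
  have emb: "embeds (B ! j) (A ! i) S"
    unfolding embeds_def
  proof (intro exI[of _ "\<lambda>k. snd (r k)"] conjI allI impI)
    show "inj_on (\<lambda>k. snd (r k)) {..<?n}" using same by (auto simp: inj_on_def)
    show "snd (r k) < length (A ! i)" "A ! i ! snd (r k) = B ! j ! k" if "k < ?n" for k
      using r[OF that] fst_r[OF that] by auto
  qed (simp add: S_def)
  then have "all_cells A G - touched G i S \<in> residues A B G j" using i by (auto simp: residues_def)
  then obtain x v where x: "x \<notin> all_cells A G - touched G i S"
    "\<forall>g\<in>set (rest 2 hs2 Y ?n). g x = Some v"
    using Y(3) unfolding sem_\<psi> by blast
  \<comment> \<open>The second component holds only cells, so a common location is never
    junk.\<close>
  have x2: "zero_heap (all_cells A G) x = Some v" "\<forall>k<?n. x \<notin> dom (Y k ! 0) \<and> x \<notin> dom (Y k ! 1)"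
    using x(2) by (auto simp: rest_def hs2_def numeral_2_eq_2 restrict_map_def split: if_splits)
  then have "x \<in> all_cells A G" by (auto simp: zero_heap_def split: if_splits)
  then obtain p q where pq: "x = cell i p q" "(p, q) \<in> G i" "p \<in> S \<or> q \<in> S"
    using x(1) by (auto simp: touched_def)
  then obtain k where k: "k < ?n" "snd (r k) = p \<or> snd (r k) = q" by (auto simp: S_def)
  then have "x \<in> piece1 A G i (snd (r k)) \<or> x \<in> piece2 G i (snd (r k))"
    using pq by (auto simp: piece1_def piece2_def)
  then show False using sub[OF k(1)] fst_r[OF k(1)] x2(2) k(1) by blast
qed

lemma not_binary_entails: "\<not> entails 2 (lhs_of \<phi>s A) (rhs_of \<psi>s B)"
proof
  assume e: "entails 2 (lhs_of \<phi>s A) (rhs_of \<psi>s B)"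
  have "IRel 2 (\<rho>2 a)" for a
    unfolding IRel_def \<rho>2_def using ext_tuple_trans by blast
  then have "sem 2 \<rho>2 (lhs_of \<phi>s A) (\<lambda>_. 0) \<subseteq> sem 2 \<rho>2 (rhs_of \<psi>s B) (\<lambda>_. 0)"
    using e unfolding entails_def by blast
  then show False using hs2_lhs hs2_not_rhs by blast
qed

end

theorem mainTheorem8:
  fixes A B :: "nat list list"
  assumes "length A \<ge> 1"
    and "\<forall>j<length B. set (B ! j) \<subseteq> Vset A"
    and "\<not> shadow A B"
    and "\<not> balloon A B"
    and "\<not> lonely A B"
  shows "\<exists>\<phi>s \<psi>s. length \<phi>s = length A \<and> length \<psi>s = length B \<and>
           (\<forall>\<phi>\<in>set \<phi>s. avars \<phi> = {}) \<and> (\<forall>\<psi>\<in>set \<psi>s. avars \<psi> = {}) \<and>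
           entails 1 (lhs_of \<phi>s A) (rhs_of \<psi>s B) \<and>
           \<not> entails 2 (lhs_of \<phi>s A) (rhs_of \<psi>s B)"
proof -
  have A: "A \<noteq> []" using assms(1) by auto
  obtain G where G: "unary_winning A B G" "length A \<ge> 2 \<or> G = (\<lambda>_. {})"
    and bounded: "\<And>i p q. (p, q) \<in> G i \<Longrightarrow> p < length (A ! i) \<and> q < length (A ! i)"
    using winning_plan_exists[OF A assms(2-5)] by blast
  have fin: "finite (all_cells A G)"
    unfolding all_cells_def using bounded by (intro finite_UN_I finite_cells) auto
  have pos: "all_cells A G \<subseteq> {0<..}" using cells_pos by (fastforce simp: all_cells_def)
  have "\<forall>i. \<exists>\<phi>. avars \<phi> = {} \<and> (\<forall>n \<rho> \<eta>. sem n \<rho> \<phi> \<eta> =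
      {hs \<in> Heaps n. \<forall>x\<in>all_cells A G - cells G i. \<forall>h\<in>set hs. h x = Some 0})"
    using fin pos by (intro allI owns_assn_exists) auto
  from choice[OF this] obtain \<phi> where \<phi>_spec: "\<forall>i. avars (\<phi> i) = {} \<and> (\<forall>n \<rho> \<eta>. sem n \<rho> (\<phi> i) \<eta> =
      {hs \<in> Heaps n. \<forall>x\<in>all_cells A G - cells G i. \<forall>h\<in>set hs. h x = Some 0})" ..
  have "\<forall>j. \<exists>\<psi>. avars \<psi> = {} \<and> (\<forall>n \<rho> \<eta>. sem n \<rho> \<psi> \<eta> =
      {hs \<in> Heaps n. \<forall>R\<in>residues A B G j. \<exists>x v. x \<notin> R \<and> 0 < x \<and> (\<forall>h\<in>set hs. h x = Some v)})"
  proof (rule allI, rule conj_assn_exists)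
    fix j
    have sub: "residues A B G j \<subseteq> Pow (all_cells A G)" by (auto simp: residues_def)
    show "finite (residues A B G j)" by (rule finite_subset[OF sub]) (simp add: fin)
    fix R assume "R \<in> residues A B G j"
    then have "finite R" using sub fin finite_subset by blast
    then show "\<exists>\<psi>. avars \<psi> = {} \<and> (\<forall>n \<rho> \<eta>. sem n \<rho> \<psi> \<eta> =
      {hs \<in> Heaps n. \<exists>x v. x \<notin> R \<and> 0 < x \<and> (\<forall>h\<in>set hs. h x = Some v)})"
      by (rule escape_assn_exists)
  qed
  from choice[OF this] obtain \<psi> where \<psi>_spec: "\<forall>j. avars (\<psi> j) = {} \<and> (\<forall>n \<rho> \<eta>. sem n \<rho> (\<psi> j) \<eta> =
      {hs \<in> Heaps n. \<forall>R\<in>residues A B G j. \<exists>x v. x \<notin> R \<and> 0 < x \<and> (\<forall>h\<in>set hs. h x = Some v)})" ..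
  interpret separating A B G \<phi> \<psi>
  proof
    show "A \<noteq> []" by (rule A)
    show "2 \<le> length A \<or> G = (\<lambda>_. {})" by (rule G(2))
  qed (fact bounded | use \<phi>_spec \<psi>_spec in simp)+
  show ?thesis
    using unary_entails[OF G(1)] not_binary_entails \<phi>_spec \<psi>_spec
    by (intro exI[of _ "\<phi>s"] exI[of _ "\<psi>s"] conjI ballI) (auto simp: \<phi>s_def \<psi>s_def)
qed

end
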